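(* Let $X\subseteq\mathcal{A}^{\mathbb{Z}}$ be a subshift, let $\mu$ be a $\sigma$-invariant probability measure with support $X$, and let $D_X$ be the associated operator on $L^2(X,\mu)$. 1. If, for some constants $C,s_0\ge1$, $\#X_n\le Cn^{s_0}$ for all $n\ge1$, then $D_X$ is $s$-summable for all $s>s_0$. 2. If $D_X$ is $s$-summable for some $s>0$, then there exists $C\ge1$ such that $\#X_n\le Cn^s$ for all $n\ge1$.
   Context: Let $\mathcal{A}$ be a finite set and $\sigma$ the left shift on $\mathcal{A}^{\mathbb{Z}}$, $\sigma(x)_n=x_{n+1}$. A subshift is a non-empty closed set $X\subseteq\mathcal{A}^{\mathbb{Z}}$ with $\sigma(X)=X$. For $n\ge1$, $X_n=\{(x_1,\dots,x_n):x\in X\}$. For $w\in X_n$, the cylinder set is $U(w)=\{x\in X:(x_{-m},\dots,x_m)=w\}$ if $n=2m+1$, and $U(w)=\{x\in X:(x_{1-m},\dots,x_m)=w\}$ if $n=2m\ge2$; $\xi(w)$ is the characteristic function of $U(w)$. Set $C_{-1}=\{0\}$, $C_0=\mathbb{C}1$, $C_n=\mathrm{span}\{\xi(w):w\in X_n\}\subseteq L^2(X,\mu)$ for $n\ge1$. $D_X$ is the operator on $L^2(X,\mu)$ with domain $\{\sum_{n\ge0}\xi_n:\xi_n\in C_n\cap C_{n-1}^\perp,\ \sum_n(n\|\xi_n\|)^2<\infty\}$ and $D_X\xi=n\xi$ for $\xi\in C_n\cap C_{n-1}^\perp$, $n\ge0$. For $s>0$, $D_X$ is called $s$-summable if $(1+D_X^2)^{-s/2}$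 is trace class. *)

theory Defs
  imports "HOL-Probability.Probability"
begin

section \<open>Subshifts\<close>

text \<open>The alphabet is a finite type with the discrete topology; the type \<open>int \<Rightarrow> 'a\<close> of
  two-sided sequences then carries the product topology.\<close>

definition left_shift :: "(int \<Rightarrow> 'a) \<Rightarrow> int \<Rightarrow> 'a" where
  "left_shift x = (\<lambda>n. x (n + 1))"

definition subshift :: "(int \<Rightarrow> 'a::{finite, discrete_topology}) set \<Rightarrow> bool" where
  "subshift X \<longleftrightarrow> X \<noteq> {} \<and> closed X \<and> left_shift ` X = X"

definition words :: "(int \<Rightarrow> 'a) set \<Rightarrow> nat \<Rightarrow> 'a list set" where
  "words X n = (\<lambda>x. map x [1..int n]) ` X"

definition cylinder :: "(int \<Rightarrow> 'a) set \<Rightarrow> 'a list \<Rightarrow> (int \<Rightarrow> 'a) set" where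
  "cylinder X w =
     (let m = int (length w div 2) in
      if odd (length w) then {x \<in> X. map x [- m..m] = w} else {x \<in> X. map x [1 - m..m] = w})"

definition measure_support :: "'b::topological_space measure \<Rightarrow> 'b set" where
  "measure_support M =
     {x \<in> space M. \<forall>V. open V \<and> x \<in> V \<longrightarrow> emeasure M (V \<inter> space M) > 0}"


section \<open>The Hilbert space of square-integrable functions\<close>

text \<open>Elements of $L^2$ are handled through representatives: vectors are square-integrable
  functions, and equality of vectors is equality almost everywhere. All subspaces and operator
  graphs below are closed under almost-everywhere equality.\<close>

definition L2 :: "'b measure \<Rightarrow> ('b \<Rightarrow> complex) set" where
  "L2 M = {f \<in> borel_measurable M. integrable M (\<lambda>x. (cmod (f x))\<^sup>2)}"

definition L2_inner :: "'b measure \<Rightarrow> ('b \<Rightarrow> complex) \<Rightarrow> ('b \<Rightarrow> complex) \<Rightarrow> complex" where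
  "L2_inner M f g = (\<integral>x. f x * cnj (g x) \<partial>M)"

definition L2_norm :: "'b measure \<Rightarrow> ('b \<Rightarrow> complex) \<Rightarrow> real" where
  "L2_norm M f = sqrt (\<integral>x. (cmod (f x))\<^sup>2 \<partial>M)"

definition L2_perp :: "'b measure \<Rightarrow> ('b \<Rightarrow> complex) set \<Rightarrow> ('b \<Rightarrow> complex) set" where
  "L2_perp M S = {f \<in> L2 M. \<forall>g\<in>S. L2_inner M f g = 0}"

definition L2_sums :: "'b measure \<Rightarrow> (nat \<Rightarrow> 'b \<Rightarrow> complex) \<Rightarrow> ('b \<Rightarrow> complex) \<Rightarrow> bool" where
  "L2_sums M u f \<longleftrightarrow>
     f \<in> L2 M \<and> (\<lambda>N. L2_norm M (\<lambda>x. f x - (\<Sum>n<N. u n x))) \<longlonglongrightarrow> 0"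

definition L2_onb :: "'b measure \<Rightarrow> ('b \<Rightarrow> complex) set \<Rightarrow> bool" where
  "L2_onb M E \<longleftrightarrow>
     E \<subseteq> L2 M \<and>
     (\<forall>e\<in>E. L2_norm M e = 1) \<and>
     (\<forall>e\<in>E. \<forall>f\<in>E. e \<noteq> f \<longrightarrow> L2_inner M e f = 0) \<and>
     (\<forall>f\<in>L2 M. \<forall>\<epsilon>>0. \<exists>F c. finite F \<and> F \<subseteq> E \<and>
        L2_norm M (\<lambda>x. f x - (\<Sum>e\<in>F. c e * e x)) < \<epsilon>)"


section \<open>Operators\<close>

text \<open>Boundedness together with linearity makes such a \<open>T\<close> well defined on classes modulo
  almost-everywhere equality.\<close>

definition bounded_op :: "'b measure \<Rightarrow> (('b \<Rightarrow> complex) \<Rightarrow> ('b \<Rightarrow> complex)) \<Rightarrow> bool" where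
  "bounded_op M T \<longleftrightarrow>
     (\<forall>f\<in>L2 M. T f \<in> L2 M) \<and>
     (\<forall>f\<in>L2 M. \<forall>g\<in>L2 M. \<forall>a b.
        AE x in M. T (\<lambda>y. a * f y + b * g y) x = a * T f x + b * T g x) \<and>
     (\<exists>K. \<forall>f\<in>L2 M. L2_norm M (T f) \<le> K * L2_norm M f)"

definition is_adjoint ::
  "'b measure \<Rightarrow> (('b \<Rightarrow> complex) \<Rightarrow> ('b \<Rightarrow> complex)) \<Rightarrow> (('b \<Rightarrow> complex) \<Rightarrow> ('b \<Rightarrow> complex)) \<Rightarrow> bool"
  where
  "is_adjoint M T S \<longleftrightarrow>
     bounded_op M S \<and> (\<forall>f\<in>L2 M. \<forall>g\<in>L2 M. L2_inner M (T f) g = L2_inner M f (S g))"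

definition positive_op :: "'b measure \<Rightarrow> (('b \<Rightarrow> complex) \<Rightarrow> ('b \<Rightarrow> complex)) \<Rightarrow> bool" where
  "positive_op M P \<longleftrightarrow>
     bounded_op M P \<and>
     (\<forall>f\<in>L2 M. Im (L2_inner M (P f) f) = 0 \<and> Re (L2_inner M (P f) f) \<ge> 0)"

text \<open>\<open>is_abs_op M T P\<close> says $P = |T| = (T^*T)^{1/2}$.\<close>

definition is_abs_op ::
  "'b measure \<Rightarrow> (('b \<Rightarrow> complex) \<Rightarrow> ('b \<Rightarrow> complex)) \<Rightarrow> (('b \<Rightarrow> complex) \<Rightarrow> ('b \<Rightarrow> complex)) \<Rightarrow> bool"
  where
  "is_abs_op M T P \<longleftrightarrow>
     positive_op M P \<and>
     (\<exists>S. is_adjoint M T S \<and> (\<forall>f\<in>L2 M. AE x in M. P (P f) x = S (T f) x))"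

definition trace_class :: "'b measure \<Rightarrow> (('b \<Rightarrow> complex) \<Rightarrow> ('b \<Rightarrow> complex)) \<Rightarrow> bool" where
  "trace_class M T \<longleftrightarrow>
     bounded_op M T \<and>
     (\<exists>P E. is_abs_op M T P \<and> L2_onb M E \<and> (\<lambda>e. Re (L2_inner M (P e) e)) summable_on E)"

text \<open>An unbounded operator is given by its graph. \<open>is_op_function M D h T\<close> says $T = h(D)$ for
  a self-adjoint operator \<open>D\<close> whose eigenvectors span a dense subspace (a diagonal operator) and
  a function \<open>h\<close> that is bounded on its eigenvalues: \<open>T\<close> is then the unique bounded operator
  acting as $h(\lambda)$ on each eigenspace $\ker(D - \lambda)$.\<close>

definition is_op_function ::
  "'b measure \<Rightarrow> (('b \<Rightarrow> complex) \<times> ('b \<Rightarrow> complex)) set \<Rightarrow> (real \<Rightarrow> real) \<Rightarrow>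
   (('b \<Rightarrow> complex) \<Rightarrow> ('b \<Rightarrow> complex)) \<Rightarrow> bool" where
  "is_op_function M D h T \<longleftrightarrow>
     bounded_op M T \<and>
     (\<forall>f l. (f, \<lambda>x. complex_of_real l * f x) \<in> D \<longrightarrow>
        (AE x in M. T f x = complex_of_real (h l) * f x))"

definition s_summable ::
  "'b measure \<Rightarrow> (('b \<Rightarrow> complex) \<times> ('b \<Rightarrow> complex)) set \<Rightarrow> real \<Rightarrow> bool" where
  "s_summable M D s \<longleftrightarrow>
     (\<exists>T. is_op_function M D (\<lambda>l. (1 + l\<^sup>2) powr (- s / 2)) T \<and> trace_class M T)"


section \<open>The operator of a subshift\<close>

definition cyl_space ::
  "(int \<Rightarrow> 'a) set \<Rightarrow> (int \<Rightarrow> 'a) measure \<Rightarrow> int \<Rightarrow> ((int \<Rightarrow> 'a) \<Rightarrow> complex) set" where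
  "cyl_space X \<mu> n =
     (if n < 0 then {f \<in> L2 \<mu>. AE x in \<mu>. f x = 0}
      else if n = 0 then {f \<in> L2 \<mu>. \<exists>c. AE x in \<mu>. f x = c}
      else {f \<in> L2 \<mu>. \<exists>c. AE x in \<mu>.
              f x = (\<Sum>w\<in>words X (nat n). c w * indicator (cylinder X w) x)})"

text \<open>The graph of $D_X$: its domain consists of the $\sum_n \xi_n$ with
  $\xi_n \in C_n \cap C_{n-1}^\perp$ and $\sum_n (n \|\xi_n\|)^2 < \infty$, and such a vector is
  mapped to $\sum_n n \xi_n$.\<close>

definition subshift_op ::
  "(int \<Rightarrow> 'a) set \<Rightarrow> (int \<Rightarrow> 'a) measure \<Rightarrow>
   (((int \<Rightarrow> 'a) \<Rightarrow> complex) \<times> ((int \<Rightarrow> 'a) \<Rightarrow> complex)) set" where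
  "subshift_op X \<mu> =
     {(f, g). \<exists>u :: nat \<Rightarrow> (int \<Rightarrow> 'a) \<Rightarrow> complex.
        (\<forall>n. u n \<in> cyl_space X \<mu> (int n) \<inter> L2_perp \<mu> (cyl_space X \<mu> (int n - 1))) \<and>
        summable (\<lambda>n. (real n * L2_norm \<mu> (u n))\<^sup>2) \<and>
        L2_sums \<mu> u f \<and>
        L2_sums \<mu> (\<lambda>n x. of_nat n * u n x) g}"

end

theory Submission
  imports Defs "HOL-Real_Asymp.Real_Asymp"
begin

text \<open>
  Let \<open>E\<^sub>n\<close> be the orthogonal projection onto \<open>C\<^sub>n\<close>. The cylinders of length \<open>n\<close> partition \<open>X\<close>, and each
  has positive measure because it is a non-empty relatively open subset of the support; so \<open>E\<^sub>n\<close>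
  averages over cylinders, it has rank \<open>p\<^sub>n = #X\<^sub>n\<close>, and \<open>D\<^sub>X\<close> acts as \<open>n\<close> on the range of
  \<open>E\<^sub>n - E\<^sub>n\<^sub>-\<^sub>1\<close>. Put \<open>\<lambda>\<^sub>n = (1 + n\<^sup>2)\<^sup>-\<^sup>s\<^sup>/\<^sup>2\<close>, the eigenvalue of \<open>(1 + D\<^sub>X\<^sup>2)\<^sup>-\<^sup>s\<^sup>/\<^sup>2\<close> there. Everything about
  operators is proved for an arbitrary refining sequence of finite partitions into cells of positive
  measure that generates the sigma-algebra (locale \<open>refining_partitions\<close>).

  Polynomial complexity implies summability. Summation by parts turns
  \<open>\<Sum>\<^sub>n \<lambda>\<^sub>n (E\<^sub>n - E\<^sub>n\<^sub>-\<^sub>1)\<close> into \<open>T = \<Sum>\<^sub>n (\<lambda>\<^sub>n - \<lambda>\<^sub>n\<^sub>+\<^sub>1) E\<^sub>n\<close>, whose coefficients are non-negative with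
  finite sum. Since the \<open>E\<^sub>n\<close> are contractions, the series \<open>T f\<close> converges absolutely almost everywhere,
  which defines \<open>T f\<close> pointwise. The operator \<open>T\<close> is symmetric and
  positive, hence its own absolute value. By Bessel's inequality, \<open>\<Sum>\<^sub>e \<parallel>E\<^sub>n e\<parallel>\<^sup>2 \<le> p\<^sub>n\<close> over every
  orthonormal set, so the trace of \<open>T\<close> is at most \<open>\<Sum>\<^sub>n (\<lambda>\<^sub>n - \<lambda>\<^sub>n\<^sub>+\<^sub>1) p\<^sub>n\<close> in every orthonormal basis; this is
  \<open>s_summable_number_op\<close>. The differences are \<open>O(n\<^sup>-\<^sup>s\<^sup>-\<^sup>1)\<close>, so the series converges if
  \<open>p\<^sub>n \<le> C n\<^sup>t\<close> with \<open>t < s\<close>. An orthonormal basis exists by Gram-Schmidt applied to the countably many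
  indicators of cells (\<open>L2_onb_exists\<close>, \<open>L2_closed_subspace_total\<close>).

  Summability implies polynomial complexity. Let \<open>P\<close> be the absolute value of \<open>(1 + D\<^sub>X\<^sup>2)\<^sup>-\<^sup>s\<^sup>/\<^sup>2\<close>. It acts as
  \<open>\<lambda>\<^sub>k\<close> on the range of \<open>E\<^sub>k - E\<^sub>k\<^sub>-\<^sub>1\<close>, so it is at least \<open>\<lambda>\<^sub>n\<close> on \<open>C\<^sub>n\<close>, and it leaves \<open>C\<^sub>n\<close> invariant; being
  symmetric and positive it satisfies \<open>\<langle>P e, e\<rangle> \<ge> \<lambda>\<^sub>n \<parallel>E\<^sub>n e\<parallel>\<^sup>2\<close>. Parseval's identity gives
  \<open>\<Sum>\<^sub>e \<parallel>E\<^sub>n e\<parallel>\<^sup>2 = p\<^sub>n\<close> over an orthonormal basis. Hence \<open>\<lambda>\<^sub>n p\<^sub>n\<close> is bounded by the trace of \<open>P\<close>, which is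
  \<open>card_cells_bound_if_s_summable\<close>, and \<open>1 / \<lambda>\<^sub>n\<close> grows like \<open>n\<^sup>s\<close>.
\<close>

section \<open>Square-integrable functions\<close>

lemma L2_measurable: "f \<in> L2 M \<Longrightarrow> f \<in> borel_measurable M"
  by (simp add: L2_def)

lemma L2_square_integrable: "f \<in> L2 M \<Longrightarrow> integrable M (\<lambda>x. (cmod (f x))\<^sup>2)"
  by (simp add: L2_def)

lemma L2_lincomb:
  assumes "f \<in> L2 M" "g \<in> L2 M"
  shows "(\<lambda>x. a * f x + b * g x) \<in> L2 M"
proof -
  have [measurable]: "f \<in> borel_measurable M" "g \<in> borel_measurable M"
    using assms by (auto simp: L2_def)
  have bound: "(cmod (u + v))\<^sup>2 \<le> 2 * (cmod u)\<^sup>2 + 2 * (cmod v)\<^sup>2" for u v :: complex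
  proof -
    have "(cmod (u + v))\<^sup>2 \<le> (cmod u + cmod v)\<^sup>2"
      by (intro power_mono norm_triangle_ineq) auto
    also have "\<dots> \<le> 2 * (cmod u)\<^sup>2 + 2 * (cmod v)\<^sup>2"
      using sum_squares_bound[of "cmod u" "cmod v"] by (simp add: power2_sum)
    finally show ?thesis .
  qed
  have "integrable M (\<lambda>x. (cmod (a * f x + b * g x))\<^sup>2)"
  proof (rule Bochner_Integration.integrable_bound)
    show "integrable M (\<lambda>x. 2 * (cmod a)\<^sup>2 * (cmod (f x))\<^sup>2 + 2 * (cmod b)\<^sup>2 * (cmod (g x))\<^sup>2)"
      using assms by (auto simp: L2_def)
    show "AE x in M. norm ((cmod (a * f x + b * g x))\<^sup>2) \<le>
        norm (2 * (cmod a)\<^sup>2 * (cmod (f x))\<^sup>2 + 2 * (cmod b)\<^sup>2 * (cmod (g x))\<^sup>2)"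
      using bound[of "a * f x" "b * g x" for x]
      by (auto simp: norm_mult power_mult_distrib mult.assoc)
  qed measurable
  then show ?thesis by (auto simp: L2_def)
qed

lemma L2_zero: "(\<lambda>x. 0) \<in> L2 M"
  by (simp add: L2_def)

lemma L2_scale: "f \<in> L2 M \<Longrightarrow> (\<lambda>x. a * f x) \<in> L2 M"
  using L2_lincomb[of f M f a 0] by simp

lemma L2_add: "f \<in> L2 M \<Longrightarrow> g \<in> L2 M \<Longrightarrow> (\<lambda>x. f x + g x) \<in> L2 M"
  using L2_lincomb[of f M g 1 1] by simp

lemma L2_diff: "f \<in> L2 M \<Longrightarrow> g \<in> L2 M \<Longrightarrow> (\<lambda>x. f x - g x) \<in> L2 M"
  using L2_lincomb[of f M g 1 "-1"] by simp

lemma L2_sum: "(\<And>i. i \<in> I \<Longrightarrow> f i \<in> L2 M) \<Longrightarrow> (\<lambda>x. \<Sum>i\<in>I. f i x) \<in> L2 M"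
  by (induction I rule: infinite_finite_induct) (auto intro: L2_zero L2_add)

lemmas L2_closed = L2_zero L2_scale L2_add L2_diff L2_sum

text \<open>Both parts come from \<open>u v \<le> u\<^sup>2 + v\<^sup>2\<close>. The crude bound on the integral is a majorant that depends only on
  the norms, as required for dominating a series of such integrals.\<close>

lemma L2_mult_integrable:
  assumes "f \<in> L2 M" "g \<in> L2 M"
  shows "integrable M (\<lambda>x. cmod (f x) * cmod (g x))"
    and "(\<integral>x. cmod (f x) * cmod (g x) \<partial>M) \<le> (L2_norm M f)\<^sup>2 + (L2_norm M g)\<^sup>2"
proof -
  have [measurable]: "f \<in> borel_measurable M" "g \<in> borel_measurable M"
    using assms by (auto simp: L2_def)
  have b: "u * v \<le> u\<^sup>2 + v\<^sup>2" for u v :: real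
    using sum_squares_bound[of u v] zero_le_power2[of u] zero_le_power2[of v]
    by (cases "0 \<le> u * v") linarith+
  have i: "integrable M (\<lambda>x. (cmod (f x))\<^sup>2 + (cmod (g x))\<^sup>2)"
    using assms by (auto simp: L2_def)
  show *: "integrable M (\<lambda>x. cmod (f x) * cmod (g x))"
    using b by (intro Bochner_Integration.integrable_bound[OF i]) auto
  have "(\<integral>x. cmod (f x) * cmod (g x) \<partial>M) \<le> (\<integral>x. (cmod (f x))\<^sup>2 + (cmod (g x))\<^sup>2 \<partial>M)"
    using b by (intro integral_mono * i) auto
  also have "\<dots> = (L2_norm M f)\<^sup>2 + (L2_norm M g)\<^sup>2"
    using assms by (simp add: L2_def L2_norm_def)
  finally show "(\<integral>x. cmod (f x) * cmod (g x) \<partial>M) \<le> (L2_norm M f)\<^sup>2 + (L2_norm M g)\<^sup>2" .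
qed

lemma borel_measurable_cnj:
  "f \<in> borel_measurable M \<Longrightarrow> (\<lambda>x. cnj (f x)) \<in> borel_measurable M"
  by (rule measurable_compose, assumption, rule borel_measurable_continuous_onI)
    (intro continuous_intros)

lemma L2_inner_integrable:
  assumes "f \<in> L2 M" "g \<in> L2 M"
  shows "integrable M (\<lambda>x. f x * cnj (g x))"
proof -
  have [measurable]: "f \<in> borel_measurable M" "(\<lambda>x. cnj (g x)) \<in> borel_measurable M"
    using assms by (auto simp: L2_def borel_measurable_cnj)
  show ?thesis
    by (rule Bochner_Integration.integrable_bound[OF L2_mult_integrable(1)[OF assms]])
      (auto simp: norm_mult)
qed

lemma L2_inner_add_left:
  "f \<in> L2 M \<Longrightarrow> g \<in> L2 M \<Longrightarrow> h \<in> L2 M \<Longrightarrow>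
    L2_inner M (\<lambda>x. f x + g x) h = L2_inner M f h + L2_inner M g h"
  unfolding L2_inner_def by (simp add: distrib_right L2_inner_integrable)

lemma L2_inner_scale_left: "L2_inner M (\<lambda>x. a * f x) h = a * L2_inner M f h"
  unfolding L2_inner_def by (simp add: mult.assoc)

lemma L2_inner_commute: "L2_inner M g f = cnj (L2_inner M f g)"
proof -
  have "cnj (L2_inner M f g) = (\<integral>x. cnj (f x * cnj (g x)) \<partial>M)"
    unfolding L2_inner_def by (rule Bochner_Integration.integral_cnj[symmetric])
  then show ?thesis
    by (simp add: L2_inner_def mult.commute)
qed

lemma L2_inner_add_right:
  "f \<in> L2 M \<Longrightarrow> g \<in> L2 M \<Longrightarrow> h \<in> L2 M \<Longrightarrow>
    L2_inner M h (\<lambda>x. f x + g x) = L2_inner M h f + L2_inner M h g"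
  by (simp add: L2_inner_commute[of M h] L2_inner_add_left)

lemma L2_inner_scale_right: "L2_inner M h (\<lambda>x. a * f x) = cnj a * L2_inner M h f"
  by (simp add: L2_inner_commute[of M h] L2_inner_scale_left)

lemma L2_inner_diff_left:
  "f \<in> L2 M \<Longrightarrow> g \<in> L2 M \<Longrightarrow> h \<in> L2 M \<Longrightarrow>
    L2_inner M (\<lambda>x. f x - g x) h = L2_inner M f h - L2_inner M g h"
  using L2_inner_add_left[of f M "\<lambda>x. -1 * g x" h] L2_inner_scale_left[of M "-1" g h]
    L2_scale[of g M "-1"] by simp

lemma L2_inner_diff_right:
  "f \<in> L2 M \<Longrightarrow> g \<in> L2 M \<Longrightarrow> h \<in> L2 M \<Longrightarrow>
    L2_inner M h (\<lambda>x. f x - g x) = L2_inner M h f - L2_inner M h g"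
  by (simp add: L2_inner_commute[of M h] L2_inner_diff_left)

lemma L2_inner_zero_left: "L2_inner M (\<lambda>x. 0) h = 0"
  by (simp add: L2_inner_def)

lemma L2_inner_zero_right: "L2_inner M h (\<lambda>x. 0) = 0"
  by (simp add: L2_inner_def)

lemma L2_inner_sum_left:
  assumes "\<And>i. i \<in> I \<Longrightarrow> f i \<in> L2 M" "h \<in> L2 M"
  shows "L2_inner M (\<lambda>x. \<Sum>i\<in>I. f i x) h = (\<Sum>i\<in>I. L2_inner M (f i) h)"
  using assms
  by (induction I rule: infinite_finite_induct)
    (auto simp: L2_inner_zero_left L2_inner_add_left L2_closed)

lemma L2_inner_sum_right:
  assumes "\<And>i. i \<in> I \<Longrightarrow> f i \<in> L2 M" "h \<in> L2 M"
  shows "L2_inner M h (\<lambda>x. \<Sum>i\<in>I. f i x) = (\<Sum>i\<in>I. L2_inner M h (f i))"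
  by (simp add: L2_inner_commute[of M h] L2_inner_sum_left assms)

lemma L2_inner_cong_AE:
  assumes "f \<in> L2 M" "g \<in> L2 M" "f' \<in> L2 M" "g' \<in> L2 M"
    and "AE x in M. f x = f' x" "AE x in M. g x = g' x"
  shows "L2_inner M f g = L2_inner M f' g'"
  unfolding L2_inner_def
proof (rule integral_cong_AE)
  show "AE x in M. f x * cnj (g x) = f' x * cnj (g' x)"
    using assms(5,6) by eventually_elim simp
qed (use assms in \<open>auto intro: borel_measurable_integrable L2_inner_integrable\<close>)

lemma L2_norm_cong_AE:
  assumes "f \<in> L2 M" "g \<in> L2 M" "AE x in M. f x = g x"
  shows "L2_norm M f = L2_norm M g"
proof -
  have "(\<integral>x. (cmod (f x))\<^sup>2 \<partial>M) = (\<integral>x. (cmod (g x))\<^sup>2 \<partial>M)"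
    using assms(3) by (intro integral_cong_AE borel_measurable_integrable
        L2_square_integrable assms) auto
  then show ?thesis by (simp add: L2_norm_def)
qed

lemma L2_norm_nonneg: "L2_norm M f \<ge> 0"
  by (simp add: L2_norm_def)

lemma L2_inner_self: "L2_inner M f f = complex_of_real ((L2_norm M f)\<^sup>2)"
proof -
  have "L2_inner M f f = (\<integral>x. complex_of_real ((cmod (f x))\<^sup>2) \<partial>M)"
    unfolding L2_inner_def by (simp only: complex_norm_square)
  also have "\<dots> = complex_of_real (\<integral>x. (cmod (f x))\<^sup>2 \<partial>M)"
    by (rule integral_complex_of_real)
  finally show ?thesis by (simp add: L2_norm_def)
qed

lemma L2_norm_square: "(L2_norm M f)\<^sup>2 = Re (L2_inner M f f)"
  by (simp add: L2_inner_self)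

lemma L2_norm_eq_0_iff:
  assumes "f \<in> L2 M"
  shows "L2_norm M f = 0 \<longleftrightarrow> (AE x in M. f x = 0)"
proof -
  have "L2_norm M f = 0 \<longleftrightarrow> (\<integral>x. (cmod (f x))\<^sup>2 \<partial>M) = 0"
    by (simp add: L2_norm_def)
  also have "\<dots> \<longleftrightarrow> (AE x in M. (cmod (f x))\<^sup>2 = 0)"
    by (intro integral_nonneg_eq_0_iff_AE L2_square_integrable assms) auto
  finally show ?thesis by simp
qed

lemma L2_eq_AE_if_norm_diff_0:
  assumes "f \<in> L2 M" "g \<in> L2 M" "L2_norm M (\<lambda>x. f x - g x) = 0"
  shows "AE x in M. f x = g x"
  using L2_norm_eq_0_iff[OF L2_diff[OF assms(1,2)]] assms(3) by simp

lemma L2_norm_scale: "L2_norm M (\<lambda>x. a * f x) = cmod a * L2_norm M f"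
  unfolding L2_norm_def by (simp add: norm_mult power_mult_distrib real_sqrt_mult)

lemma L2_norm_add_square:
  assumes "f \<in> L2 M" "g \<in> L2 M"
  shows "(L2_norm M (\<lambda>x. f x + g x))\<^sup>2 =
    (L2_norm M f)\<^sup>2 + (L2_norm M g)\<^sup>2 + 2 * Re (L2_inner M f g)"
  using assms L2_inner_commute[of M g f]
  by (simp add: L2_norm_square L2_inner_add_left L2_inner_add_right L2_closed)

text \<open>The square of the distance from @ to a multiple\<close>

text \<open>The difference of \<open>f\<close> and its projection onto the line spanned by \<open>g\<close> has non-negative square norm.\<close>

lemma L2_Cauchy_Schwarz:
  assumes "f \<in> L2 M" "g \<in> L2 M"
  shows "cmod (L2_inner M f g) \<le> L2_norm M f * L2_norm M g"
proof (cases "L2_norm M g = 0")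
  case True
  then have "AE x in M. g x = 0" using L2_norm_eq_0_iff assms by blast
  then have "L2_inner M f g = L2_inner M f (\<lambda>x. 0)"
    using assms by (intro L2_inner_cong_AE) (auto intro: L2_zero)
  then show ?thesis by (simp add: True L2_inner_zero_right)
next
  case False
  define b where "b = (L2_norm M g)\<^sup>2"
  define z where "z = L2_inner M f g"
  have b: "b > 0" using False by (simp add: b_def)
  define a where "a = - z / b"
  have az: "Re (cnj a * z) = - (cmod z)\<^sup>2 / b"
  proof -
    have "cnj a * z = - complex_of_real ((cmod z)\<^sup>2) / b"
      by (simp only: complex_norm_square a_def) simp
    then show ?thesis by (simp flip: of_real_power of_real_divide of_real_minus)
  qed
  have "0 \<le> (L2_norm M (\<lambda>x. f x + a * g x))\<^sup>2" by simp
  also have "\<dots> = (L2_norm M f)\<^sup>2 + (L2_norm M (\<lambda>x. a * g x))\<^sup>2 +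
      2 * Re (L2_inner M f (\<lambda>x. a * g x))"
    by (intro L2_norm_add_square L2_scale assms)
  also have "\<dots> = (L2_norm M f)\<^sup>2 + (cmod a)\<^sup>2 * b + 2 * Re (cnj a * z)"
    by (simp only: L2_norm_scale L2_inner_scale_right power_mult_distrib b_def z_def)
  also have "\<dots> = (L2_norm M f)\<^sup>2 - (cmod z)\<^sup>2 / b"
    unfolding az using b by (simp add: a_def norm_divide field_simps power2_eq_square)
  finally have "(cmod z)\<^sup>2 \<le> (L2_norm M f)\<^sup>2 * b"
    using b by (simp add: field_simps)
  then have "(cmod z)\<^sup>2 \<le> (L2_norm M f * L2_norm M g)\<^sup>2"
    by (simp add: b_def power_mult_distrib)
  then show ?thesis
    unfolding z_def by (rule power2_le_imp_le) (simp add: L2_norm_nonneg)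
qed

lemma L2_norm_triangle:
  assumes "f \<in> L2 M" "g \<in> L2 M"
  shows "L2_norm M (\<lambda>x. f x + g x) \<le> L2_norm M f + L2_norm M g"
proof (rule power2_le_imp_le)
  have "Re (L2_inner M f g) \<le> L2_norm M f * L2_norm M g"
    using complex_Re_le_cmod L2_Cauchy_Schwarz[OF assms] by (rule order_trans)
  then show "(L2_norm M (\<lambda>x. f x + g x))\<^sup>2 \<le> (L2_norm M f + L2_norm M g)\<^sup>2"
    by (simp add: L2_norm_add_square[OF assms] power2_sum)
qed (simp add: L2_norm_nonneg)

text \<open>Orthogonal complements are closed, by the Cauchy-Schwarz inequality.\<close>

lemma L2_inner_eq_0_if_approx:
  assumes "f \<in> L2 M" "g \<in> L2 M"
    and approx: "\<And>\<epsilon>. \<epsilon> > 0 \<Longrightarrow> \<exists>h\<in>L2 M. L2_inner M h g = 0 \<and> L2_norm M (\<lambda>x. f x - h x) < \<epsilon>"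
  shows "L2_inner M f g = 0"
proof (rule ccontr)
  assume "L2_inner M f g \<noteq> 0"
  then have pos: "cmod (L2_inner M f g) / (L2_norm M g + 1) > 0"
    using L2_norm_nonneg[of M g] by (intro divide_pos_pos) auto
  obtain h where h: "h \<in> L2 M" "L2_inner M h g = 0"
      "L2_norm M (\<lambda>x. f x - h x) < cmod (L2_inner M f g) / (L2_norm M g + 1)"
    using approx[OF pos] by blast
  have "cmod (L2_inner M f g) = cmod (L2_inner M (\<lambda>x. f x - h x) g)"
    using assms h by (simp add: L2_inner_diff_left)
  also have "\<dots> \<le> L2_norm M (\<lambda>x. f x - h x) * L2_norm M g"
    using assms h by (intro L2_Cauchy_Schwarz L2_diff)
  also have "\<dots> \<le> L2_norm M (\<lambda>x. f x - h x) * (L2_norm M g + 1)"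
    by (intro mult_left_mono L2_norm_nonneg) auto
  also have "\<dots> < cmod (L2_inner M f g)"
    using h(3) L2_norm_nonneg[of M g] by (simp add: pos_less_divide_eq)
  finally show False by simp
qed

text \<open>The inner product is continuous in its first argument, so it may be taken term by term.\<close>

lemma L2_sums_inner:
  assumes "L2_sums M u f" "\<And>n. u n \<in> L2 M" "g \<in> L2 M"
  shows "(\<lambda>n. L2_inner M (u n) g) sums L2_inner M f g"
proof -
  have f: "f \<in> L2 M" and lim: "(\<lambda>N. L2_norm M (\<lambda>x. f x - (\<Sum>n<N. u n x))) \<longlonglongrightarrow> 0"
    using assms(1) by (auto simp: L2_sums_def)
  have "(\<lambda>N. L2_inner M f g - (\<Sum>n<N. L2_inner M (u n) g)) \<longlonglongrightarrow> 0"
  proof (rule Lim_null_comparison)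
    show "(\<lambda>N. L2_norm M (\<lambda>x. f x - (\<Sum>n<N. u n x)) * L2_norm M g) \<longlonglongrightarrow> 0"
      using lim by (auto intro: tendsto_mult_left_zero)
    have "L2_inner M f g - (\<Sum>n<N. L2_inner M (u n) g) =
        L2_inner M (\<lambda>x. f x - (\<Sum>n<N. u n x)) g" for N
      using assms f by (simp add: L2_inner_diff_left L2_inner_sum_left L2_closed)
    then show "\<forall>\<^sub>F N in sequentially. norm (L2_inner M f g - (\<Sum>n<N. L2_inner M (u n) g)) \<le>
        L2_norm M (\<lambda>x. f x - (\<Sum>n<N. u n x)) * L2_norm M g"
      using assms f by (auto intro!: always_eventually L2_Cauchy_Schwarz L2_closed)
  qed
  from tendsto_diff[OF tendsto_const[of "L2_inner M f g"] this] show ?thesis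
    by (simp add: sums_def)
qed

section \<open>Orthonormal families\<close>

definition L2_orthonormal :: "'b measure \<Rightarrow> ('b \<Rightarrow> complex) set \<Rightarrow> bool" where
  "L2_orthonormal M E \<longleftrightarrow>
     E \<subseteq> L2 M \<and> (\<forall>e\<in>E. L2_norm M e = 1) \<and>
     (\<forall>e\<in>E. \<forall>f\<in>E. e \<noteq> f \<longrightarrow> L2_inner M e f = 0)"

lemma L2_orthonormal_subset: "L2_orthonormal M E \<Longrightarrow> F \<subseteq> E \<Longrightarrow> L2_orthonormal M F"
  unfolding L2_orthonormal_def by (meson subset_trans subsetD)

lemma L2_orthonormal_inner:
  "L2_orthonormal M E \<Longrightarrow> e \<in> E \<Longrightarrow> f \<in> E \<Longrightarrow> L2_inner M e f = (if e = f then 1 else 0)"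
  unfolding L2_orthonormal_def by (auto simp: L2_inner_self)

lemma L2_orthonormal_inner_sum:
  assumes "L2_orthonormal M F" "finite F" "e \<in> F"
  shows "L2_inner M (\<lambda>x. \<Sum>e\<in>F. c e * e x) e = c e"
proof -
  have L: "f \<in> L2 M" if "f \<in> F" for f
    using assms(1) that by (auto simp: L2_orthonormal_def)
  have "L2_inner M (\<lambda>x. \<Sum>e\<in>F. c e * e x) e = (\<Sum>f\<in>F. c f * L2_inner M f e)"
    using L assms(3) by (simp add: L2_inner_sum_left L2_inner_scale_left L2_scale)
  also have "\<dots> = (\<Sum>f\<in>F. if f = e then c e else 0)"
    using assms by (intro sum.cong) (auto simp: L2_orthonormal_inner[OF assms(1)])
  finally show ?thesis using assms by simp
qed

text \<open>Completing the square in the coefficients. The choice \<open>c e = \<langle>f, e\<rangle>\<close> gives Bessel's inequality; for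
  arbitrary \<open>c\<close> the last sum is non-negative, so every approximation of \<open>f\<close> bounds the defect in Bessel's
  inequality from above, which gives Parseval's identity.\<close>

lemma L2_distance_to_span:
  assumes F: "L2_orthonormal M F" "finite F" and f: "f \<in> L2 M"
  shows "(L2_norm M (\<lambda>x. f x - (\<Sum>e\<in>F. c e * e x)))\<^sup>2 =
    (L2_norm M f)\<^sup>2 - (\<Sum>e\<in>F. (cmod (L2_inner M f e))\<^sup>2) +
    (\<Sum>e\<in>F. (cmod (c e - L2_inner M f e))\<^sup>2)"
proof -
  have L: "e \<in> L2 M" if "e \<in> F" for e
    using F(1) that by (auto simp: L2_orthonormal_def)
  define g where "g = (\<lambda>x. \<Sum>e\<in>F. c e * e x)"
  have g: "g \<in> L2 M" unfolding g_def using L by (intro L2_closed) auto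
  have hg: "L2_inner M h g = (\<Sum>e\<in>F. cnj (c e) * L2_inner M h e)" if "h \<in> L2 M" for h
    unfolding g_def using L that
    by (simp add: L2_inner_sum_right L2_inner_scale_right L2_scale)
  have gg: "L2_inner M g g = (\<Sum>e\<in>F. cnj (c e) * c e)"
    using hg[OF g] L2_orthonormal_inner_sum[OF F, of _ c, folded g_def]
    by (simp cong: sum.cong)
  have "complex_of_real ((L2_norm M (\<lambda>x. f x - g x))\<^sup>2) =
      L2_inner M f f - L2_inner M f g - cnj (L2_inner M f g) + L2_inner M g g"
    using f g L2_inner_commute[of M g f]
    by (simp add: L2_inner_self[symmetric] L2_inner_diff_left L2_inner_diff_right L2_diff
        del: of_real_power)
  also have "\<dots> = complex_of_real ((L2_norm M f)\<^sup>2) +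
      (\<Sum>e\<in>F. (c e - L2_inner M f e) * cnj (c e - L2_inner M f e) -
         L2_inner M f e * cnj (L2_inner M f e))"
    unfolding hg[OF f] gg L2_inner_self[of M f]
    by (simp add: algebra_simps sum_subtractf sum.distrib)
  also have "\<dots> = complex_of_real ((L2_norm M f)\<^sup>2 +
      (\<Sum>e\<in>F. (cmod (c e - L2_inner M f e))\<^sup>2 - (cmod (L2_inner M f e))\<^sup>2))"
    by (simp only: of_real_add of_real_sum of_real_diff complex_norm_square)
  finally show ?thesis
    unfolding g_def of_real_eq_iff by (simp add: sum_subtractf)
qed

lemma L2_Bessel:
  assumes "L2_orthonormal M F" "finite F" "f \<in> L2 M"
  shows "(\<Sum>e\<in>F. (cmod (L2_inner M f e))\<^sup>2) \<le> (L2_norm M f)\<^sup>2"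
  using L2_distance_to_span[OF assms, of "L2_inner M f"] 
    zero_le_power2[of "L2_norm M (\<lambda>x. f x - (\<Sum>e\<in>F. L2_inner M f e * e x))"] by simp

lemma L2_onb_orthonormal: "L2_onb M E \<Longrightarrow> L2_orthonormal M E"
  by (auto simp: L2_onb_def L2_orthonormal_def)

lemma L2_Parseval:
  assumes "L2_onb M E" "f \<in> L2 M"
  shows "((\<lambda>e. (cmod (L2_inner M f e))\<^sup>2) has_sum (L2_norm M f)\<^sup>2) E"
proof -
  let ?c = "\<lambda>e. (cmod (L2_inner M f e))\<^sup>2"
  note on = L2_onb_orthonormal[OF assms(1)]
  have bessel: "sum ?c F \<le> (L2_norm M f)\<^sup>2" if "finite F" "F \<subseteq> E" for F
    using L2_Bessel[OF L2_orthonormal_subset[OF on] _ assms(2)] that by blast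
  have summable: "?c summable_on E"
    by (intro nonneg_bdd_above_summable_on) (auto intro!: bdd_aboveI2 bessel)
  have "(L2_norm M f)\<^sup>2 \<le> infsum ?c E"
  proof (rule field_le_epsilon)
    fix \<epsilon> :: real assume "\<epsilon> > 0"
    then have "sqrt \<epsilon> > 0" by simp
    then obtain F c where F: "finite F" "F \<subseteq> E"
        and less: "L2_norm M (\<lambda>x. f x - (\<Sum>e\<in>F. c e * e x)) < sqrt \<epsilon>"
      using assms unfolding L2_onb_def by blast
    have "(L2_norm M f)\<^sup>2 - sum ?c F \<le> (L2_norm M (\<lambda>x. f x - (\<Sum>e\<in>F. c e * e x)))\<^sup>2"
      by (simp add: L2_distance_to_span[OF L2_orthonormal_subset[OF on F(2)] F(1) assms(2)]
          sum_nonneg)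
    also have "\<dots> \<le> (sqrt \<epsilon>)\<^sup>2"
      using less by (intro power_mono L2_norm_nonneg) auto
    finally show "(L2_norm M f)\<^sup>2 \<le> infsum ?c E + \<epsilon>"
      using finite_sum_le_infsum[OF summable F] \<open>\<epsilon> > 0\<close> by simp
  qed
  moreover have "infsum ?c E \<le> (L2_norm M f)\<^sup>2"
    by (intro infsum_le_finite_sums summable bessel)
  ultimately show ?thesis
    using has_sum_infsum[OF summable] by (metis antisym)
qed

section \<open>Closed subspaces and orthonormal bases\<close>

text \<open>Closedness is phrased by approximation. Such a set is automatically closed under equality almost
  everywhere, since functions that agree almost everywhere have distance zero.\<close>

definition L2_closed_subspace :: "'b measure \<Rightarrow> ('b \<Rightarrow> complex) set \<Rightarrow> bool" where
  "L2_closed_subspace M V \<longleftrightarrow>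
     V \<subseteq> L2 M \<and>
     (\<forall>f\<in>V. \<forall>g\<in>V. \<forall>a b. (\<lambda>x. a * f x + b * g x) \<in> V) \<and>
     (\<forall>f\<in>L2 M. (\<forall>\<epsilon>>0. \<exists>h\<in>V. L2_norm M (\<lambda>x. f x - h x) < \<epsilon>) \<longrightarrow> f \<in> V)"

lemma L2_closed_subspaceD:
  assumes "L2_closed_subspace M V"
  shows "f \<in> V \<Longrightarrow> f \<in> L2 M"
    and "f \<in> V \<Longrightarrow> g \<in> V \<Longrightarrow> (\<lambda>x. a * f x + b * g x) \<in> V"
    and "f \<in> L2 M \<Longrightarrow> (\<And>\<epsilon>. \<epsilon> > 0 \<Longrightarrow> \<exists>h\<in>V. L2_norm M (\<lambda>x. f x - h x) < \<epsilon>) \<Longrightarrow> f \<in> V"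
  using assms unfolding L2_closed_subspace_def by (meson subsetD)+

lemma L2_closed_subspace_sum:
  assumes "L2_closed_subspace M V" "finite I" "\<And>i. i \<in> I \<Longrightarrow> f i \<in> V" "V \<noteq> {}"
  shows "(\<lambda>x. \<Sum>i\<in>I. c i * f i x) \<in> V"
  using assms(2,3)
proof (induction I rule: finite_induct)
  case empty
  obtain g where "g \<in> V" using assms(4) by blast
  from L2_closed_subspaceD(2)[OF assms(1) this this, of 0 0] show ?case by simp
next
  case (insert i I)
  then have "(\<lambda>x. c i * f i x + 1 * (\<Sum>i\<in>I. c i * f i x)) \<in> V"
    by (intro L2_closed_subspaceD(2)[OF assms(1)]) auto
  then show ?case using insert by simp
qed

lemma L2_indicator:
  assumes "finite_measure M" "A \<in> sets M"
  shows "indicator A \<in> L2 M"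
proof -
  interpret finite_measure M by fact
  have "(\<lambda>x. (cmod (indicator A x))\<^sup>2) = (indicator A :: _ \<Rightarrow> real)"
    by (auto simp: indicator_def fun_eq_iff)
  moreover have "integrable M (indicator A :: _ \<Rightarrow> real)"
    using assms(2) by (rule integrable_real_indicator) (simp add: less_top[symmetric])
  ultimately show ?thesis
    using assms(2) by (simp add: L2_def)
qed

lemma L2_dominated_convergence:
  assumes f: "f \<in> L2 M" and g: "\<And>n. g n \<in> L2 M" and w: "integrable M w"
    and lim: "\<And>x. x \<in> space M \<Longrightarrow> (\<lambda>n. g n x) \<longlonglongrightarrow> f x"
    and bound: "\<And>n x. x \<in> space M \<Longrightarrow> (cmod (f x - g n x))\<^sup>2 \<le> w x"
  shows "(\<lambda>n. L2_norm M (\<lambda>x. f x - g n x)) \<longlonglongrightarrow> 0"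
proof -
  have meas: "(\<lambda>x. (cmod (f x - g n x))\<^sup>2) \<in> borel_measurable M" for n
    by (intro borel_measurable_integrable L2_square_integrable L2_diff f g)
  have "(\<lambda>n. \<integral>x. (cmod (f x - g n x))\<^sup>2 \<partial>M) \<longlonglongrightarrow> (\<integral>x. 0 \<partial>M)"
  proof (rule integral_dominated_convergence[OF _ meas w])
    show "AE x in M. (\<lambda>n. (cmod (f x - g n x))\<^sup>2) \<longlonglongrightarrow> 0"
    proof (rule AE_I2)
      fix x assume "x \<in> space M"
      have "(\<lambda>n. (cmod (f x - g n x))\<^sup>2) \<longlonglongrightarrow> (cmod (f x - f x))\<^sup>2"
        using lim[OF \<open>x \<in> space M\<close>] by (intro tendsto_intros)
      then show "(\<lambda>n. (cmod (f x - g n x))\<^sup>2) \<longlonglongrightarrow> 0" by simp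
    qed
    show "AE x in M. norm ((cmod (f x - g n x))\<^sup>2) \<le> w x" for n
      using bound by (intro AE_I2) simp
  qed simp
  from tendsto_real_sqrt[OF this] show ?thesis
    by (simp add: L2_norm_def)
qed

lemma L2_closed_subspace_limit:
  assumes V: "L2_closed_subspace M V" and f: "f \<in> L2 M" and g: "\<And>n. g n \<in> V"
    and lim: "(\<lambda>n. L2_norm M (\<lambda>x. f x - g n x)) \<longlonglongrightarrow> 0"
  shows "f \<in> V"
proof (rule L2_closed_subspaceD(3)[OF V f])
  fix \<epsilon> :: real assume "\<epsilon> > 0"
  from eventually_happens'[OF sequentially_bot order_tendstoD(2)[OF lim this]]
  obtain n where "L2_norm M (\<lambda>x. f x - g n x) < \<epsilon>" ..
  then show "\<exists>h\<in>V. L2_norm M (\<lambda>x. f x - h x) < \<epsilon>" using g by blast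
qed

text \<open>A density statement: the sets whose indicator lies in the subspace form a Dynkin system, because
  countable disjoint unions are \<open>L\<^sup>2\<close>-limits of finite ones; simple functions are then covered by linearity
  and all functions by dominated convergence.\<close>

lemma L2_closed_subspace_total:
  fixes M :: "'b measure"
  assumes fin: "finite_measure M"
    and gen: "sets M = sigma_sets (space M) G" and G: "Int_stable G"
    and V: "L2_closed_subspace M V"
    and ind: "\<And>A. A \<in> G \<Longrightarrow> indicator A \<in> V" and ind_space: "indicator (space M) \<in> V"
  shows "V = L2 M"
proof -
  interpret finite_measure M by fact
  have GP: "G \<subseteq> Pow (space M)"
    using gen sets.space_closed[of M] sigma_sets.Basic[of _ G "space M"] by blast
  note lin = L2_closed_subspaceD(2)[OF V]
  have sets_ind: "indicator A \<in> V" if "A \<in> sets M" for A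
  proof -
    have "A \<in> sigma_sets (space M) G" using that gen by simp
    from G GP this show ?thesis
    proof (induction rule: sigma_sets_induct_disjoint)
      case (basic A)
      then show ?case by (rule ind)
    next
      case empty
      show ?case using lin[OF ind_space ind_space, of 0 0] by (simp add: indicator_def)
    next
      case (compl A)
      have "(\<lambda>x. 1 * indicator (space M) x + (-1) * indicator A x :: complex) =
          indicator (space M - A)"
        using compl(1) gen sets.sets_into_space[of A M]
        by (auto simp: fun_eq_iff indicator_def)
      then show ?case using lin[OF ind_space compl(2), of 1 "-1"] by simp
    next
      case (union A)
      have A: "A i \<in> sets M" for i using union(2) gen by blast
      have fin_un: "indicator (\<Union>i<N. A i) \<in> V" for N
      proof (induction N)
        case 0
        show ?case using lin[OF ind_space ind_space, of 0 0] by (simp add: indicator_def)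
      next
        case (Suc N)
        have "A N \<inter> (\<Union>i<N. A i) = {}"
          using disjoint_family_onD[OF union(1), of N] by fastforce
        then have "(\<lambda>x. 1 * indicator (\<Union>i<N. A i) x + 1 * indicator (A N) x :: complex) =
            indicator (\<Union>i<Suc N. A i)"
          by (auto simp: fun_eq_iff indicator_def less_Suc_eq)
        then show ?case using lin[OF Suc union(3)[of N], of 1 1] by simp
      qed
      show ?case
      proof (rule L2_closed_subspace_limit[OF V _ fin_un])
        show "indicator (\<Union>i. A i) \<in> L2 M"
          using A by (intro L2_indicator fin) auto
        show "(\<lambda>N. L2_norm M (\<lambda>x. indicator (\<Union>i. A i) x - indicator (\<Union>i<N. A i) x)) \<longlonglongrightarrow> 0"
        proof (rule L2_dominated_convergence[where w = "\<lambda>_. 1"])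
          show "indicator (\<Union>i. A i) \<in> L2 M" "indicator (\<Union>i<n. A i) \<in> L2 M" for n
            using A by (auto intro!: L2_indicator fin)
          show "(\<lambda>n. indicator (\<Union>i<n. A i) x :: complex) \<longlonglongrightarrow> indicator (\<Union>i. A i) x" for x
            by (rule LIMSEQ_indicator_UN)
          show "(cmod (indicator (\<Union>i. A i) x - indicator (\<Union>i<n. A i) x))\<^sup>2 \<le> 1" for n x
            by (auto simp: indicator_def)
        qed simp
      qed
    qed
  qed
  have "f \<in> V" if f: "f \<in> L2 M" for f
  proof -
    obtain s where s: "\<And>i. simple_function M (s i)"
        "\<And>x. x \<in> space M \<Longrightarrow> (\<lambda>i. s i x) \<longlonglongrightarrow> f x"
        "\<And>i x. x \<in> space M \<Longrightarrow> dist (s i x) 0 \<le> 2 * dist (f x) 0"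
      using borel_measurable_implies_sequence_metric[OF L2_measurable[OF f], of 0] by metis
    \<comment> \<open>Off the space of the measure a simple function is unconstrained, so its canonical form is
      used instead.\<close>
    define t where "t i x = (\<Sum>y\<in>s i ` space M. y * indicator (s i -` {y} \<inter> space M) x)" for i x
    have t_eq: "t i x = s i x" if "x \<in> space M" for i x
    proof -
      have "t i x = (\<Sum>y\<in>s i ` space M. if y = s i x then y else 0)"
        unfolding t_def using that by (intro sum.cong) (auto simp: indicator_def)
      then show ?thesis using that simple_functionD(1)[OF s(1), of i] by simp
    qed
    have tV: "t i \<in> V" for i
      unfolding t_def
    proof (rule L2_closed_subspace_sum[OF V])
      show "finite (s i ` space M)" using s(1) by (rule simple_functionD)
      show "indicator (s i -` {y} \<inter> space M) \<in> V" for y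
        by (intro sets_ind simple_functionD s)
    qed (use ind_space in blast)
    show "f \<in> V"
    proof (rule L2_closed_subspace_limit[OF V f tV])
      show "(\<lambda>n. L2_norm M (\<lambda>x. f x - t n x)) \<longlonglongrightarrow> 0"
      proof (rule L2_dominated_convergence[OF f])
        show "t n \<in> L2 M" for n using L2_closed_subspaceD(1)[OF V tV] .
        show "integrable M (\<lambda>x. 9 * (cmod (f x))\<^sup>2)"
          using L2_square_integrable[OF f] by simp
        show "(\<lambda>n. t n x) \<longlonglongrightarrow> f x" if "x \<in> space M" for x
          using s(2)[OF that] t_eq[OF that] by simp
        show "(cmod (f x - t n x))\<^sup>2 \<le> 9 * (cmod (f x))\<^sup>2" if "x \<in> space M" for n x
        proof -
          have "cmod (f x - t n x) \<le> 3 * cmod (f x)"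
            using s(3)[OF that, of n] norm_triangle_ineq4[of "f x" "s n x"] t_eq[OF that]
            by simp
          from power_mono[OF this, of 2] show ?thesis by (simp add: power_mult_distrib)
        qed
      qed
    qed
  qed
  then show ?thesis using L2_closed_subspaceD(1)[OF V] by blast
qed

lemma L2_closed_subspace_perp:
  assumes g: "g \<in> L2 M"
  shows "L2_closed_subspace M {f \<in> L2 M. L2_inner M f g = 0}"
  unfolding L2_closed_subspace_def
proof (intro conjI ballI allI impI)
  fix f assume "f \<in> L2 M" "\<forall>\<epsilon>>0. \<exists>h\<in>{f \<in> L2 M. L2_inner M f g = 0}. L2_norm M (\<lambda>x. f x - h x) < \<epsilon>"
  then show "f \<in> {f \<in> L2 M. L2_inner M f g = 0}"
    using L2_inner_eq_0_if_approx[OF _ g] by (auto simp: Bex_def)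
qed (use g in \<open>auto simp: L2_closed L2_inner_add_left L2_inner_scale_left\<close>)

text \<open>The functions that finite linear combinations from \<open>E\<close> approximate form a closed subspace; hence, to
  see that \<open>E\<close> spans a dense subspace, it suffices to approximate a total family.\<close>

lemma L2_closed_span:
  assumes E: "E \<subseteq> L2 M"
  shows "L2_closed_subspace M
    {f \<in> L2 M. \<forall>\<epsilon>>0. \<exists>F c. finite F \<and> F \<subseteq> E \<and> L2_norm M (\<lambda>x. f x - (\<Sum>e\<in>F. c e * e x)) < \<epsilon>}"
    (is "L2_closed_subspace M ?V")
  unfolding L2_closed_subspace_def
proof (intro conjI ballI allI impI)
  have L: "(\<lambda>x. \<Sum>e\<in>F. c e * e x) \<in> L2 M" if "F \<subseteq> E" for F c
    using that E by (intro L2_closed) auto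
  show "?V \<subseteq> L2 M" by blast
  show "f \<in> ?V" if f: "f \<in> L2 M" and lim: "\<forall>\<epsilon>>0. \<exists>h\<in>?V. L2_norm M (\<lambda>x. f x - h x) < \<epsilon>" for f
  proof (intro CollectI conjI allI impI f)
    fix \<epsilon> :: real assume "\<epsilon> > 0"
    then have "\<epsilon> / 2 > 0" by simp
    then obtain h where h: "h \<in> ?V" "L2_norm M (\<lambda>x. f x - h x) < \<epsilon> / 2" using lim by blast
    then obtain F c where F: "finite F" "F \<subseteq> E"
        "L2_norm M (\<lambda>x. h x - (\<Sum>e\<in>F. c e * e x)) < \<epsilon> / 2"
      using \<open>\<epsilon> / 2 > 0\<close> by blast
    have "L2_norm M (\<lambda>x. (f x - h x) + (h x - (\<Sum>e\<in>F. c e * e x))) < \<epsilon>"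
      using L2_norm_triangle[OF L2_diff[OF f, of h] L2_diff[OF _ L[OF F(2)], of h c]] h F by simp
    then show "\<exists>F c. finite F \<and> F \<subseteq> E \<and> L2_norm M (\<lambda>x. f x - (\<Sum>e\<in>F. c e * e x)) < \<epsilon>"
      using F by auto
  qed
  show "(\<lambda>x. a * f x + b * g x) \<in> ?V" if f: "f \<in> ?V" and g: "g \<in> ?V" for f g a b
  proof (intro CollectI conjI allI impI)
    show "(\<lambda>x. a * f x + b * g x) \<in> L2 M" using f g by (auto intro: L2_lincomb)
    fix \<epsilon> :: real assume "\<epsilon> > 0"
    \<comment> \<open>The summand 1 keeps the denominator positive when both coefficients vanish.\<close>
    define \<delta> where "\<delta> = \<epsilon> / (cmod a + cmod b + 1)"
    have den: "cmod a + cmod b + 1 > 0" using norm_ge_zero[of a] norm_ge_zero[of b] by linarith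
    have "\<delta> > 0" using \<open>\<epsilon> > 0\<close> den by (simp add: \<delta>_def)
    then obtain F c G d where F: "finite F" "F \<subseteq> E"
          "L2_norm M (\<lambda>x. f x - (\<Sum>e\<in>F. c e * e x)) < \<delta>"
        and G: "finite G" "G \<subseteq> E" "L2_norm M (\<lambda>x. g x - (\<Sum>e\<in>G. d e * e x)) < \<delta>"
      using f g by blast
    \<comment> \<open>The index sets of the two approximations are merged by extending the coefficients by zero.\<close>
    define k where "k e = a * (if e \<in> F then c e else 0) + b * (if e \<in> G then d e else 0)" for e
    have k: "(\<Sum>e\<in>F \<union> G. k e * e x) = a * (\<Sum>e\<in>F. c e * e x) + b * (\<Sum>e\<in>G. d e * e x)" for x
    proof -
      have "(\<Sum>e\<in>F \<union> G. k e * e x) =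
          a * (\<Sum>e\<in>F \<union> G. if e \<in> F then c e * e x else 0) +
          b * (\<Sum>e\<in>F \<union> G. if e \<in> G then d e * e x else 0)"
        unfolding sum_distrib_left sum.distrib[symmetric]
        by (rule sum.cong) (auto simp: k_def algebra_simps)
      moreover have "(\<Sum>e\<in>F \<union> G. if e \<in> F then c e * e x else 0) = (\<Sum>e\<in>F. c e * e x)"
        "(\<Sum>e\<in>F \<union> G. if e \<in> G then d e * e x else 0) = (\<Sum>e\<in>G. d e * e x)"
        using F G by (simp_all flip: sum.inter_restrict add: Int_absorb1)
      ultimately show ?thesis by simp
    qed
    let ?f = "\<lambda>x. f x - (\<Sum>e\<in>F. c e * e x)" and ?g = "\<lambda>x. g x - (\<Sum>e\<in>G. d e * e x)"
    have "(\<lambda>x. a * f x + b * g x - (\<Sum>e\<in>F \<union> G. k e * e x)) = (\<lambda>x. a * ?f x + b * ?g x)"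
      unfolding k by (simp add: right_diff_distrib add_diff_add)
    moreover have "L2_norm M (\<lambda>x. a * ?f x + b * ?g x) \<le> cmod a * L2_norm M ?f + cmod b * L2_norm M ?g"
      unfolding L2_norm_scale[symmetric] using f g L F G
      by (intro L2_norm_triangle L2_scale L2_diff) auto
    moreover have "\<dots> \<le> cmod a * \<delta> + cmod b * \<delta>"
      using F G by (intro add_mono mult_left_mono) auto
    moreover have "\<dots> < (cmod a + cmod b + 1) * \<delta>"
      using \<open>\<delta> > 0\<close> by (simp add: algebra_simps)
    moreover have "\<dots> = \<epsilon>" using den by (simp add: \<delta>_def)
    ultimately have "L2_norm M (\<lambda>x. a * f x + b * g x - (\<Sum>e\<in>F \<union> G. k e * e x)) < \<epsilon>"
      by (simp only:)
    then show "\<exists>F c. finite F \<and> F \<subseteq> E \<and>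
        L2_norm M (\<lambda>x. a * f x + b * g x - (\<Sum>e\<in>F. c e * e x)) < \<epsilon>"
      using F G by (intro exI[of _ "F \<union> G"] exI[of _ k]) auto
  qed
qed

text \<open>The residual of \<open>g\<close> after projection to the span of \<open>F\<close> is either null, and nothing is added, or its
  normalisation is a new unit vector orthogonal to \<open>F\<close>.\<close>

lemma L2_Gram_Schmidt_step:
  assumes F: "L2_orthonormal M F" "finite F" and g: "g \<in> L2 M"
  shows "\<exists>F'. L2_orthonormal M F' \<and> finite F' \<and> F \<subseteq> F' \<and>
    (\<exists>c. L2_norm M (\<lambda>x. g x - (\<Sum>e\<in>F'. c e * e x)) = 0)"
proof -
  define c where "c = L2_inner M g"
  define h where "h = (\<lambda>x. g x - (\<Sum>e\<in>F. c e * e x))"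
  have L: "e \<in> L2 M" if "e \<in> F" for e using F that by (auto simp: L2_orthonormal_def)
  have h: "h \<in> L2 M" unfolding h_def using L g by (intro L2_closed) auto
  have perp: "L2_inner M h e = 0" if "e \<in> F" for e
  proof -
    have "L2_inner M h e = L2_inner M g e - L2_inner M (\<lambda>x. \<Sum>e\<in>F. c e * e x) e"
      unfolding h_def using L that g by (intro L2_inner_diff_left L2_closed) auto
    then show ?thesis using L2_orthonormal_inner_sum[OF F that, of c] by (simp add: c_def)
  qed
  show ?thesis
  proof (cases "L2_norm M h = 0")
    case True
    then show ?thesis using F unfolding h_def by blast
  next
    case False
    define r where "r = complex_of_real (L2_norm M h)"
    define e0 where "e0 = (\<lambda>x. inverse r * h x)"
    have r: "r \<noteq> 0" using False by (simp add: r_def)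
    have e0: "e0 \<in> L2 M" unfolding e0_def by (intro L2_scale h)
    have norm_e0: "L2_norm M e0 = 1"
      using False L2_norm_nonneg[of M h] unfolding e0_def L2_norm_scale r_def
      by (simp add: norm_inverse)
    have perp0: "L2_inner M e0 e = 0" "L2_inner M e e0 = 0" if "e \<in> F" for e
      using perp[OF that] L2_inner_commute[of M e h]
      by (simp_all add: e0_def L2_inner_scale_left L2_inner_scale_right)
    have "e0 \<notin> F" using perp0(1)[of e0] norm_e0 by (auto simp: L2_inner_self)
    have "L2_orthonormal M (insert e0 F)"
      using F(1) e0 norm_e0 perp0 unfolding L2_orthonormal_def by auto
    moreover have "g x - (\<Sum>e\<in>insert e0 F. (c(e0 := r)) e * e x) = 0" for x
    proof -
      have "(\<Sum>e\<in>F. (c(e0 := r)) e * e x) = (\<Sum>e\<in>F. c e * e x)"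
        using \<open>e0 \<notin> F\<close> by (intro sum.cong) auto
      then have "(\<Sum>e\<in>insert e0 F. (c(e0 := r)) e * e x) = r * e0 x + (\<Sum>e\<in>F. c e * e x)"
        using F(2) \<open>e0 \<notin> F\<close> by simp
      moreover have "r * e0 x = h x" using r by (simp add: e0_def mult.assoc[symmetric])
      ultimately show ?thesis by (simp add: h_def)
    qed
    then have "L2_norm M (\<lambda>x. g x - (\<Sum>e\<in>insert e0 F. (c(e0 := r)) e * e x)) = 0"
      unfolding L2_norm_def by simp
    ultimately show ?thesis using F(2) by blast
  qed
qed

text \<open>Iterating the Gram-Schmidt step along a sequence produces an increasing chain of finite orthonormal
  sets; the \<open>n\<close>-th vector has distance zero from the span of the next set. If the sequence is total,
  the union of the chain is an orthonormal basis.\<close>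

lemma L2_onb_exists:
  fixes g :: "nat \<Rightarrow> 'b \<Rightarrow> complex"
  assumes g: "\<And>n. g n \<in> L2 M"
    and total: "\<And>V. L2_closed_subspace M V \<Longrightarrow> range g \<subseteq> V \<Longrightarrow> L2 M \<subseteq> V"
  shows "\<exists>E. L2_onb M E"
proof -
  let ?P = "\<lambda>(n::nat) F. L2_orthonormal M F \<and> finite F"
  let ?Q = "\<lambda>n F F'. F \<subseteq> F' \<and> (\<exists>c. L2_norm M (\<lambda>x. g n x - (\<Sum>e\<in>F'. c e * e x)) = 0)"
  have "\<exists>F. \<forall>n. ?P n (F n) \<and> ?Q n (F n) (F (Suc n))"
  proof (rule dependent_nat_choice)
    show "\<exists>F. ?P 0 F" by (intro exI[of _ "{}"]) (simp add: L2_orthonormal_def)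
    show "\<exists>F'. ?P (Suc n) F' \<and> ?Q n F F'" if "?P n F" for F n
      using L2_Gram_Schmidt_step[OF _ _ g[of n], of F] that by blast
  qed
  then obtain F where F: "\<And>n. L2_orthonormal M (F n)" "\<And>n. finite (F n)"
      "\<And>n. F n \<subseteq> F (Suc n)"
      "\<And>n. \<exists>c. L2_norm M (\<lambda>x. g n x - (\<Sum>e\<in>F (Suc n). c e * e x)) = 0"
    by blast
  have mono: "F m \<subseteq> F n" if "m \<le> n" for m n
    using lift_Suc_mono_le[of F, OF F(3) that] .
  define E where "E = (\<Union>n. F n)"
  have pair: "\<exists>n. e \<in> F n \<and> f \<in> F n" if "e \<in> E" "f \<in> E" for e f
  proof -
    from that obtain m n where "e \<in> F m" "f \<in> F n" by (auto simp: E_def)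
    then show ?thesis using mono[of m "max m n"] mono[of n "max m n"] by auto
  qed
  have on: "L2_orthonormal M E"
    unfolding L2_orthonormal_def
  proof (intro conjI ballI impI)
    show "E \<subseteq> L2 M" using F(1) unfolding E_def L2_orthonormal_def by (intro UN_least) blast
    show "L2_norm M e = 1" if "e \<in> E" for e
      using pair[OF that that] F(1) unfolding L2_orthonormal_def by blast
    show "L2_inner M e f = 0" if "e \<in> E" "f \<in> E" "e \<noteq> f" for e f
      using pair[OF that(1,2)] that(3) F(1) L2_orthonormal_inner by fastforce
  qed
  then have EL: "E \<subseteq> L2 M" by (simp add: L2_orthonormal_def)
  have "L2 M \<subseteq> {f \<in> L2 M. \<forall>\<epsilon>>0. \<exists>F c. finite F \<and> F \<subseteq> E \<and>
      L2_norm M (\<lambda>x. f x - (\<Sum>e\<in>F. c e * e x)) < \<epsilon>}"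
  proof (rule total[OF L2_closed_span[OF EL]], intro image_subsetI CollectI conjI allI impI g)
    fix n and \<epsilon> :: real assume "\<epsilon> > 0"
    from F(4)[of n] obtain c where "L2_norm M (\<lambda>x. g n x - (\<Sum>e\<in>F (Suc n). c e * e x)) = 0"
      by blast
    then have "L2_norm M (\<lambda>x. g n x - (\<Sum>e\<in>F (Suc n). c e * e x)) < \<epsilon>"
      using \<open>\<epsilon> > 0\<close> by simp
    then show "\<exists>F c. finite F \<and> F \<subseteq> E \<and> L2_norm M (\<lambda>x. g n x - (\<Sum>e\<in>F. c e * e x)) < \<epsilon>"
      using F(2)[of "Suc n"] by (intro exI[of _ "F (Suc n)"] exI[of _ c]) (auto simp: E_def)
  qed
  then have "\<forall>f\<in>L2 M. \<forall>\<epsilon>>0. \<exists>F c. finite F \<and> F \<subseteq> E \<and>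
      L2_norm M (\<lambda>x. f x - (\<Sum>e\<in>F. c e * e x)) < \<epsilon>"
    by (simp add: subset_iff)
  then have "L2_onb M E"
    using on unfolding L2_onb_def L2_orthonormal_def by (elim conjE, intro conjI)
  then show ?thesis by blast
qed

section \<open>Bounded and positive operators\<close>

lemma bounded_opD:
  assumes "bounded_op M T"
  shows "f \<in> L2 M \<Longrightarrow> T f \<in> L2 M"
    and "f \<in> L2 M \<Longrightarrow> g \<in> L2 M \<Longrightarrow>
      AE x in M. T (\<lambda>y. a * f y + b * g y) x = a * T f x + b * T g x"
  using assms unfolding bounded_op_def by blast+

lemma bounded_op_bound:
  assumes "bounded_op M T"
  obtains K where "\<And>f. f \<in> L2 M \<Longrightarrow> L2_norm M (T f) \<le> K * L2_norm M f"
  using assms unfolding bounded_op_def by (elim conjE exE) blast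

text \<open>Boundedness forces the image of a null function to be null, so a bounded operator acts on classes.\<close>

lemma bounded_op_cong_AE:
  assumes T: "bounded_op M T" and f: "f \<in> L2 M" and g: "g \<in> L2 M" and eq: "AE x in M. f x = g x"
  shows "AE x in M. T f x = T g x"
proof -
  obtain K where K: "\<And>h. h \<in> L2 M \<Longrightarrow> L2_norm M (T h) \<le> K * L2_norm M h"
    using bounded_op_bound[OF T] by blast
  let ?d = "\<lambda>y. 1 * f y + (-1) * g y"
  have d: "?d \<in> L2 M" by (intro L2_lincomb f g)
  have "L2_norm M ?d = 0" using eq by (subst L2_norm_eq_0_iff[OF d]) auto
  then have "L2_norm M (T ?d) = 0" using K[OF d] L2_norm_nonneg[of M "T ?d"] by simp
  then have "AE x in M. T ?d x = 0"
    using L2_norm_eq_0_iff[OF bounded_opD(1)[OF T d]] by blast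
  moreover have "AE x in M. T ?d x = 1 * T f x + (-1) * T g x"
    by (rule bounded_opD(2)[OF T f g])
  ultimately show ?thesis by eventually_elim simp
qed

lemma bounded_op_form_add:
  assumes P: "bounded_op M P" and f: "f \<in> L2 M" and g: "g \<in> L2 M"
  shows "L2_inner M (P (\<lambda>x. 1 * f x + z * g x)) (\<lambda>x. 1 * f x + z * g x) =
    L2_inner M (P f) f + cnj z * L2_inner M (P f) g + z * L2_inner M (P g) f +
    z * cnj z * L2_inner M (P g) g"
proof -
  note Pf = bounded_opD(1)[OF P f] and Pg = bounded_opD(1)[OF P g]
  have h: "(\<lambda>x. 1 * f x + z * g x) \<in> L2 M" by (intro L2_lincomb f g)
  have "L2_inner M (P (\<lambda>x. 1 * f x + z * g x)) (\<lambda>x. 1 * f x + z * g x) =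
      L2_inner M (\<lambda>x. 1 * P f x + z * P g x) (\<lambda>x. 1 * f x + z * g x)"
    by (rule L2_inner_cong_AE[OF bounded_opD(1)[OF P h] h L2_lincomb[OF Pf Pg] h
          bounded_opD(2)[OF P f g]]) simp
  also have "\<dots> = L2_inner M (P f) f + cnj z * L2_inner M (P f) g + z * L2_inner M (P g) f +
      z * cnj z * L2_inner M (P g) g"
    using f g Pf Pg
    by (simp add: L2_inner_add_left L2_inner_add_right L2_inner_scale_left L2_inner_scale_right
        L2_scale L2_add algebra_simps)
  finally show ?thesis .
qed

text \<open>Polarization: the form \<open>\<langle>P h, h\<rangle>\<close> is real for \<open>h = f + g\<close> and for \<open>h = f + \<i> g\<close>, which yields the
  imaginary and the real part of the identity.\<close>

lemma positive_op_symmetric: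
  assumes P: "positive_op M P" and f: "f \<in> L2 M" and g: "g \<in> L2 M"
  shows "L2_inner M (P f) g = L2_inner M f (P g)"
proof -
  have b: "bounded_op M P" and im: "\<And>h. h \<in> L2 M \<Longrightarrow> Im (L2_inner M (P h) h) = 0"
    using P by (auto simp: positive_op_def)
  have "Im (cnj z * L2_inner M (P f) g + z * L2_inner M (P g) f) = 0" for z
  proof -
    have "Im (L2_inner M (P f) f + cnj z * L2_inner M (P f) g + z * L2_inner M (P g) f +
        z * cnj z * L2_inner M (P g) g) = 0"
      unfolding bounded_op_form_add[OF b f g, symmetric] by (intro im L2_lincomb f g)
    then show ?thesis using im[OF f] im[OF g] by simp
  qed
  from this[of 1] this[of \<i>] have "L2_inner M (P f) g = cnj (L2_inner M (P g) f)"
    by (simp add: complex_eq_iff)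
  then show ?thesis by (simp add: L2_inner_commute[of M f])
qed

section \<open>Refining sequences of finite partitions\<close>

lemma has_sum_finite_sum:
  fixes f :: "'i \<Rightarrow> 'e \<Rightarrow> real"
  assumes "\<And>i. i \<in> I \<Longrightarrow> (f i has_sum s i) E"
  shows "((\<lambda>e. \<Sum>i\<in>I. f i e) has_sum (\<Sum>i\<in>I. s i)) E"
  using assms by (induction I rule: infinite_finite_induct) (auto intro: has_sum_add)

text \<open>The cells of level \<open>n\<close> model the cylinders of words of length \<open>n\<close>. Positivity of their measures makes
  their indicators linearly independent modulo null functions, so the step functions of level \<open>n\<close> form
  a space whose dimension is the number of cells.\<close>

locale refining_partitions = prob_space M for M :: "'b measure" +
  fixes cells :: "nat \<Rightarrow> 'b set set"
  assumes finite_cells: "finite (cells n)"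
    and disjoint_cells: "disjoint (cells n)"
    and Union_cells: "\<Union>(cells n) = space M"
    and cells_sets: "A \<in> cells n \<Longrightarrow> A \<in> sets M"
    and cells_pos: "A \<in> cells n \<Longrightarrow> measure M A > 0"
    and cells_refine: "B \<in> cells (Suc n) \<Longrightarrow> \<exists>A\<in>cells n. B \<subseteq> A"
    and cells_generate: "sets M = sigma_sets (space M) (\<Union>n. cells n)"
begin

lemma cells_L2: "A \<in> cells n \<Longrightarrow> indicator A \<in> L2 M"
  by (intro L2_indicator finite_measure_axioms cells_sets)

lemma sum_cells_indicator:
  assumes "A \<in> cells n" "x \<in> A"
  shows "(\<Sum>B\<in>cells n. c B * indicator B x) = (c A :: complex)"
proof -
  have "(\<Sum>B\<in>cells n. c B * indicator B x) = (\<Sum>B\<in>cells n. if B = A then c A else 0)"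
    using assms disjointD[OF disjoint_cells assms(1)] by (intro sum.cong) (auto simp: indicator_def)
  then show ?thesis using assms finite_cells by simp
qed

lemma cells_refine_le: "m \<le> n \<Longrightarrow> B \<in> cells n \<Longrightarrow> \<exists>A\<in>cells m. B \<subseteq> A"
proof (induction n arbitrary: B rule: dec_induct)
  case (step n)
  then show ?case using cells_refine[of B n] by (meson order_trans)
qed blast

text \<open>Two cells are either nested or disjoint.\<close>

lemma Int_stable_cells: "Int_stable (insert {} (\<Union>n. cells n))"
proof -
  have *: "A \<inter> B \<in> insert {} (\<Union>n. cells n)" 
    if mn: "m \<le> n" and "A \<in> cells m" and BB: "B \<in> cells n" for A B m n
  proof -
    obtain A' where "A' \<in> cells m" "B \<subseteq> A'" using cells_refine_le[OF mn BB] by blast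
    then have "A \<inter> B = {} \<or> A \<inter> B = B"
      using disjointD[OF disjoint_cells \<open>A \<in> cells m\<close> \<open>A' \<in> cells m\<close>] by blast
    then show ?thesis using that by auto
  qed
  show ?thesis
    unfolding Int_stable_def
  proof (intro ballI)
    fix A B assume "A \<in> insert {} (\<Union>n. cells n)" "B \<in> insert {} (\<Union>n. cells n)"
    then consider "A = {} \<or> B = {}" | m n where "A \<in> cells m" "B \<in> cells n" by auto
    then show "A \<inter> B \<in> insert {} (\<Union>n. cells n)"
    proof cases
      case 2
      then show ?thesis using *[of m n A B] *[of n m B A] by (cases "m \<le> n") (auto simp: Int_commute)
    qed auto
  qed
qed

definition steps :: "nat \<Rightarrow> ('b \<Rightarrow> complex) set" where
  "steps n = {f \<in> L2 M. \<exists>c. AE x in M. f x = (\<Sum>A\<in>cells n. c A * indicator A x)}"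

text \<open>The level below 0 consists of the null functions, in accordance with \<open>C\<^sub>-\<^sub>1 = {0}\<close>.\<close>

definition lower_steps :: "nat \<Rightarrow> ('b \<Rightarrow> complex) set" where
  "lower_steps n = (case n of 0 \<Rightarrow> {f \<in> L2 M. AE x in M. f x = 0} | Suc k \<Rightarrow> steps k)"

definition layer :: "nat \<Rightarrow> ('b \<Rightarrow> complex) set" where
  "layer n = steps n \<inter> L2_perp M (lower_steps n)"

text \<open>The orthogonal projection onto the step functions of level \<open>n\<close>, that is, the conditional expectation
  given the cells of level \<open>n\<close>.\<close>

definition avg :: "nat \<Rightarrow> ('b \<Rightarrow> complex) \<Rightarrow> 'b \<Rightarrow> complex" where
  "avg n f x = (\<Sum>A\<in>cells n. (L2_inner M f (indicator A) / measure M A) * indicator A x)"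

lemma steps_L2: "f \<in> steps n \<Longrightarrow> f \<in> L2 M"
  by (simp add: steps_def)

lemma steps_sum: "(\<lambda>x. \<Sum>A\<in>cells n. c A * indicator A x) \<in> steps n"
  unfolding steps_def by (auto intro!: L2_sum L2_scale cells_L2)

lemma steps_AE:
  assumes "f \<in> steps n" "g \<in> L2 M" "AE x in M. g x = f x"
  shows "g \<in> steps n"
proof -
  obtain c where "AE x in M. f x = (\<Sum>A\<in>cells n. c A * indicator A x)"
    using assms(1) by (auto simp: steps_def)
  with assms(3) have "AE x in M. g x = (\<Sum>A\<in>cells n. c A * indicator A x)"
    by eventually_elim simp
  then show ?thesis using assms(2) by (auto simp: steps_def)
qed

lemma steps_lincomb:
  assumes "f \<in> steps n" "g \<in> steps n"
  shows "(\<lambda>x. a * f x + b * g x) \<in> steps n"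
proof -
  obtain c d where "AE x in M. f x = (\<Sum>A\<in>cells n. c A * indicator A x)"
      "AE x in M. g x = (\<Sum>A\<in>cells n. d A * indicator A x)"
    using assms by (auto simp: steps_def)
  then have "AE x in M. a * f x + b * g x = (\<Sum>A\<in>cells n. (a * c A + b * d A) * indicator A x)"
    by eventually_elim (simp add: sum_distrib_left sum.distrib distrib_right mult.assoc)
  then show ?thesis
    using assms by (intro steps_AE[OF steps_sum]) (auto intro: L2_lincomb steps_L2)
qed

lemma steps_scale: "f \<in> steps n \<Longrightarrow> (\<lambda>x. a * f x) \<in> steps n"
  using steps_lincomb[of f n f a 0] by simp

lemma steps_diff: "f \<in> steps n \<Longrightarrow> g \<in> steps n \<Longrightarrow> (\<lambda>x. f x - g x) \<in> steps n"
  using steps_lincomb[of f n g 1 "-1"] by simp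

text \<open>A cell is the union of the finer cells that it contains.\<close>

lemma steps_Suc: "steps n \<subseteq> steps (Suc n)"
proof
  fix f assume f: "f \<in> steps n"
  then obtain c where c: "AE x in M. f x = (\<Sum>A\<in>cells n. c A * indicator A x)"
    by (auto simp: steps_def)
  define parent where "parent B = (SOME A. A \<in> cells n \<and> B \<subseteq> A)" for B
  have parent: "parent B \<in> cells n" "B \<subseteq> parent B" if "B \<in> cells (Suc n)" for B
    using someI_ex[of "\<lambda>A. A \<in> cells n \<and> B \<subseteq> A"] cells_refine[OF that]
    unfolding parent_def by blast+
  have "(\<Sum>A\<in>cells n. c A * indicator A x) = (\<Sum>B\<in>cells (Suc n). c (parent B) * indicator B x)"
    if x: "x \<in> space M" for x
  proof -
    obtain B where B: "B \<in> cells (Suc n)" "x \<in> B" using x Union_cells by blast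
    then show ?thesis
      using sum_cells_indicator[OF parent(1)[OF B(1)], of x c] parent(2)[OF B(1)]
        sum_cells_indicator[OF B, of "\<lambda>B. c (parent B)"] by auto
  qed
  note eq = this
  have "AE x in M. f x = (\<Sum>B\<in>cells (Suc n). c (parent B) * indicator B x)"
    using c AE_space by eventually_elim (simp only: eq)
  then show "f \<in> steps (Suc n)" using f by (auto simp: steps_def)
qed

lemma steps_mono: "m \<le> n \<Longrightarrow> steps m \<subseteq> steps n"
  using lift_Suc_mono_le[of steps, OF steps_Suc] .

lemma avg_steps: "avg n f \<in> steps n"
  using steps_sum[of "\<lambda>A. L2_inner M f (indicator A) / measure M A" n]
  by (simp add: avg_def[abs_def])

lemma avg_L2: "avg n f \<in> L2 M"
  using avg_steps steps_L2 by blast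

lemma avg_inner:
  assumes "g \<in> L2 M"
  shows "L2_inner M (avg n f) g =
    (\<Sum>A\<in>cells n. L2_inner M f (indicator A) * cnj (L2_inner M g (indicator A)) / measure M A)"
proof -
  have "L2_inner M (avg n f) g =
      (\<Sum>A\<in>cells n. L2_inner M (\<lambda>x. L2_inner M f (indicator A) / measure M A * indicator A x) g)"
    unfolding avg_def by (intro L2_inner_sum_left L2_scale cells_L2 assms)
  also have "\<dots> = (\<Sum>A\<in>cells n. L2_inner M f (indicator A) / measure M A * L2_inner M (indicator A) g)"
    by (simp only: L2_inner_scale_left)
  finally have "L2_inner M (avg n f) g =
      (\<Sum>A\<in>cells n. L2_inner M f (indicator A) / measure M A * L2_inner M (indicator A) g)" .
  then show ?thesis
    by (simp add: L2_inner_commute[of M _ g])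
qed

lemma avg_symmetric:
  assumes "f \<in> L2 M" "g \<in> L2 M"
  shows "L2_inner M (avg n f) g = L2_inner M f (avg n g)"
  unfolding avg_inner[OF assms(2)] L2_inner_commute[of M f] avg_inner[OF assms(1)] cnj_sum
  by (intro sum.cong) simp_all

lemma avg_perp:
  assumes f: "f \<in> L2 M" and g: "g \<in> steps n"
  shows "L2_inner M (\<lambda>x. f x - avg n f x) g = 0"
proof -
  obtain c where c: "AE x in M. g x = (\<Sum>A\<in>cells n. c A * indicator A x)"
    using g by (auto simp: steps_def)
  have h: "(\<lambda>x. f x - avg n f x) \<in> L2 M" by (intro L2_diff f avg_L2)
  have ind: "L2_inner M (\<lambda>x. f x - avg n f x) (indicator A) = 0" if A: "A \<in> cells n" for A
  proof -
    have "L2_inner M (avg n f) (indicator A) =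
        (\<Sum>B\<in>cells n. if B = A then L2_inner M f (indicator A) else 0)"
      unfolding avg_inner[OF cells_L2[OF A]]
    proof (rule sum.cong)
      fix B assume B: "B \<in> cells n"
      have "L2_inner M (indicator A) (indicator B) = (\<integral>x. complex_of_real (indicator (A \<inter> B) x) \<partial>M)"
        unfolding L2_inner_def by (intro Bochner_Integration.integral_cong) (auto simp: indicator_def)
      also have "\<dots> = complex_of_real (measure M (A \<inter> B))"
        unfolding integral_complex_of_real using cells_sets[OF A] cells_sets[OF B] by simp
      finally show "L2_inner M f (indicator B) * cnj (L2_inner M (indicator A) (indicator B)) /
          complex_of_real (measure M B) = (if B = A then L2_inner M f (indicator A) else 0)"
        using disjointD[OF disjoint_cells A B] cells_pos[OF A] by auto
    qed simp
    then show ?thesis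
      using A finite_cells f by (simp add: L2_inner_diff_left avg_L2 cells_L2)
  qed
  have "L2_inner M (\<lambda>x. f x - avg n f x) g =
      L2_inner M (\<lambda>x. f x - avg n f x) (\<lambda>x. \<Sum>A\<in>cells n. c A * indicator A x)"
    using c by (intro L2_inner_cong_AE h steps_L2[OF g] steps_L2[OF steps_sum]) auto
  also have "\<dots> = 0"
    using h ind by (simp add: L2_inner_sum_right L2_inner_scale_right L2_scale cells_L2)
  finally show ?thesis .
qed

text \<open>A step function with the same orthogonality property as \<open>avg n f\<close> differs from it by a step function
  that is orthogonal to itself.\<close>

lemma avg_unique:
  assumes f: "f \<in> L2 M" and g: "g \<in> steps n"
    and perp: "\<And>h. h \<in> steps n \<Longrightarrow> L2_inner M (\<lambda>x. f x - g x) h = 0"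
  shows "AE x in M. avg n f x = g x"
proof (rule L2_eq_AE_if_norm_diff_0[OF avg_L2 steps_L2[OF g]])
  let ?h = "\<lambda>x. avg n f x - g x"
  have h: "?h \<in> steps n" by (intro steps_diff avg_steps g)
  have "L2_inner M ?h ?h = L2_inner M (\<lambda>x. (f x - g x) - (f x - avg n f x)) ?h"
    by (simp add: algebra_simps)
  also have "\<dots> = 0"
    using perp[OF h] avg_perp[OF f h] f g h
    by (simp add: L2_inner_diff_left L2_diff avg_L2 steps_L2)
  finally show "L2_norm M ?h = 0" by (simp add: L2_inner_self)
qed

lemma avg_of_steps: "f \<in> steps n \<Longrightarrow> AE x in M. avg n f x = f x"
  by (rule avg_unique) (auto simp: steps_L2 L2_inner_zero_left)

lemma avg_norm_square:
  assumes f: "f \<in> L2 M"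
  shows "L2_inner M (avg n f) f = complex_of_real ((L2_norm M (avg n f))\<^sup>2)"
proof -
  have "L2_inner M f (avg n f) = L2_inner M (avg n f) (avg n f)"
    using avg_perp[OF f avg_steps] f by (simp add: L2_inner_diff_left avg_L2)
  then show ?thesis using avg_symmetric[OF f f] by (simp add: L2_inner_self)
qed

lemma avg_norm_le:
  assumes f: "f \<in> L2 M"
  shows "L2_norm M (avg n f) \<le> L2_norm M f"
proof (rule power2_le_imp_le[OF _ L2_norm_nonneg])
  have "(\<lambda>x. avg n f x + (f x - avg n f x)) = f" by simp
  then have "(L2_norm M f)\<^sup>2 = (L2_norm M (avg n f))\<^sup>2 + (L2_norm M (\<lambda>x. f x - avg n f x))\<^sup>2 +
      2 * Re (L2_inner M (avg n f) (\<lambda>x. f x - avg n f x))"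
    using L2_norm_add_square[OF avg_L2[of n f] L2_diff[OF f avg_L2[of n f]]] by simp
  also have "L2_inner M (avg n f) (\<lambda>x. f x - avg n f x) = 0"
    using avg_perp[OF f avg_steps[of n f]] L2_inner_commute[of M "avg n f"] by simp
  finally show "(L2_norm M (avg n f))\<^sup>2 \<le> (L2_norm M f)\<^sup>2" by simp
qed

text \<open>The indicators of the cells, divided by the square roots of the measures, are an orthonormal basis of
  the step functions.\<close>

lemma avg_norm_square_sum:
  assumes "f \<in> L2 M"
  shows "(L2_norm M (avg n f))\<^sup>2 = (\<Sum>A\<in>cells n. (cmod (L2_inner M (indicator A) f))\<^sup>2 / measure M A)"
proof -
  have "complex_of_real ((L2_norm M (avg n f))\<^sup>2) =
      (\<Sum>A\<in>cells n. complex_of_real ((cmod (L2_inner M f (indicator A)))\<^sup>2) / measure M A)"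
    unfolding avg_norm_square[OF assms, symmetric] avg_inner[OF assms] complex_norm_square ..
  also have "\<dots> = complex_of_real (\<Sum>A\<in>cells n. (cmod (L2_inner M f (indicator A)))\<^sup>2 / measure M A)"
    by simp
  finally show ?thesis
    unfolding of_real_eq_iff by (simp add: L2_inner_commute[of M _ f])
qed

lemma indicator_norm_square: "A \<in> cells n \<Longrightarrow> (L2_norm M (indicator A))\<^sup>2 = measure M A"
proof -
  assume A: "A \<in> cells n"
  have "(\<lambda>x. (cmod (indicator A x))\<^sup>2) = (indicator A :: _ \<Rightarrow> real)"
    by (auto simp: indicator_def fun_eq_iff)
  then show ?thesis using cells_sets[OF A] by (simp add: L2_norm_def)
qed

text \<open>The trace of a projection of finite rank does not exceed its rank in any orthonormal set: expand each
  \<open>\<parallel>avg n e\<parallel>\<^sup>2\<close> over the cells, interchange the sums, and apply Bessel's inequality to each indicator.\<close>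

lemma avg_trace_le:
  assumes "L2_orthonormal M F" "finite F"
  shows "(\<Sum>e\<in>F. (L2_norm M (avg n e))\<^sup>2) \<le> card (cells n)"
proof -
  have "(\<Sum>e\<in>F. (L2_norm M (avg n e))\<^sup>2) =
      (\<Sum>e\<in>F. \<Sum>A\<in>cells n. (cmod (L2_inner M (indicator A) e))\<^sup>2 / measure M A)"
    using assms by (intro sum.cong avg_norm_square_sum) (auto simp: L2_orthonormal_def)
  also have "\<dots> = (\<Sum>A\<in>cells n. (\<Sum>e\<in>F. (cmod (L2_inner M (indicator A) e))\<^sup>2) / measure M A)"
    by (subst sum.swap) (simp add: sum_divide_distrib)
  also have "\<dots> \<le> (\<Sum>A\<in>cells n. 1)"
  proof (rule sum_mono)
    fix A assume A: "A \<in> cells n"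
    show "(\<Sum>e\<in>F. (cmod (L2_inner M (indicator A) e))\<^sup>2) / measure M A \<le> 1"
      using L2_Bessel[OF assms cells_L2[OF A]] cells_pos[OF A]
      by (simp add: indicator_norm_square[OF A] divide_le_eq)
  qed
  finally show ?thesis by simp
qed

text \<open>In an orthonormal basis, Parseval's identity turns the bound into an equality.\<close>

lemma avg_trace:
  assumes E: "L2_onb M E"
  shows "((\<lambda>e. (L2_norm M (avg n e))\<^sup>2) has_sum real (card (cells n))) E"
proof -
  have "((\<lambda>e. \<Sum>A\<in>cells n. (cmod (L2_inner M (indicator A) e))\<^sup>2 / measure M A)
      has_sum (\<Sum>A\<in>cells n. 1)) E"
  proof (rule has_sum_finite_sum)
    fix A assume A: "A \<in> cells n"
    have "((\<lambda>e. (cmod (L2_inner M (indicator A) e))\<^sup>2 * (1 / measure M A))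
        has_sum (L2_norm M (indicator A))\<^sup>2 * (1 / measure M A)) E"
      by (intro has_sum_cmult_left L2_Parseval E cells_L2[OF A])
    then show "((\<lambda>e. (cmod (L2_inner M (indicator A) e))\<^sup>2 / measure M A) has_sum 1) E"
      using cells_pos[OF A] by (simp add: indicator_norm_square[OF A])
  qed
  then have "((\<lambda>e. \<Sum>A\<in>cells n. (cmod (L2_inner M (indicator A) e))\<^sup>2 / measure M A)
      has_sum real (card (cells n))) E"
    by simp
  then show ?thesis
  proof (rule has_sum_cong[THEN iffD1, rotated])
    show "(\<Sum>A\<in>cells n. (cmod (L2_inner M (indicator A) e))\<^sup>2 / measure M A) =
        (L2_norm M (avg n e))\<^sup>2" if "e \<in> E" for e
      using that E by (intro avg_norm_square_sum[symmetric]) (auto simp: L2_onb_def)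
  qed
qed

lemma closed_subspace_total:
  assumes V: "L2_closed_subspace M V" and ind: "\<And>n A. A \<in> cells n \<Longrightarrow> indicator A \<in> V"
  shows "V = L2 M"
proof (rule L2_closed_subspace_total[OF finite_measure_axioms _ Int_stable_cells V])
  show "sets M = sigma_sets (space M) (insert {} (\<Union>n. cells n))"
    unfolding cells_generate
    by (intro antisym sigma_sets_subseteq subset_insertI sigma_sets_mono)
      (auto intro: sigma_sets.intros)
  have "cells 0 \<noteq> {}" using Union_cells[of 0] not_empty by auto
  then have ne: "V \<noteq> {}" using ind by blast
  have "(\<lambda>x. \<Sum>A\<in>cells 0. 0 * indicator A x :: complex) \<in> V"
    "(\<lambda>x. \<Sum>A\<in>cells 0. 1 * indicator A x :: complex) \<in> V"
    by (intro L2_closed_subspace_sum[OF V finite_cells _ ne] ind; assumption)+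
  moreover have "(\<Sum>A\<in>cells 0. 1 * indicator A x :: complex) = indicator (space M) x" for x
    using sum_cells_indicator[of _ 0 x "\<lambda>_. 1"] Union_cells[of 0]
    by (cases "x \<in> space M") (auto simp: indicator_def intro!: sum.neutral)
  ultimately show "indicator (space M) \<in> V" by simp
  have "(indicator {} :: 'b \<Rightarrow> complex) = (\<lambda>x. \<Sum>A\<in>cells 0. 0 * indicator A x)" by (simp add: fun_eq_iff)
  then show "indicator A \<in> V" if "A \<in> insert {} (\<Union>n. cells n)" for A
    using that ind \<open>(\<lambda>x. \<Sum>A\<in>cells 0. 0 * indicator A x :: complex) \<in> V\<close> by auto
qed

lemma onb_exists: "\<exists>E. L2_onb M E"
proof (rule L2_onb_exists)
  let ?I = "(\<Union>n. (\<lambda>A. indicator A :: 'b \<Rightarrow> complex) ` cells n)"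
  have "cells 0 \<noteq> {}" using Union_cells[of 0] not_empty by auto
  then have range: "range (from_nat_into ?I) = ?I"
    using finite_cells by (intro range_from_nat_into countable_UN countable_image)
      (auto intro: countable_finite)
  show "from_nat_into ?I n \<in> L2 M" for n
    using range cells_L2 by (metis (no_types, lifting) UN_E image_iff rangeI)
  show "L2 M \<subseteq> V" if "L2_closed_subspace M V" "range (from_nat_into ?I) \<subseteq> V" for V
    using closed_subspace_total[OF that(1)] that(2) unfolding range by blast
qed

section \<open>The number operator\<close>

text \<open>The graph of the operator that acts as \<open>n\<close> on the \<open>n\<close>-th layer.\<close>

definition number_op :: "(('b \<Rightarrow> complex) \<times> ('b \<Rightarrow> complex)) set" where
  "number_op = {(f, g). \<exists>u. (\<forall>n. u n \<in> layer n) \<and>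
     summable (\<lambda>n. (real n * L2_norm M (u n))\<^sup>2) \<and>
     L2_sums M u f \<and> L2_sums M (\<lambda>n x. of_nat n * u n x) g}"

lemma layer_steps: "f \<in> layer n \<Longrightarrow> f \<in> steps n"
  by (simp add: layer_def)

lemma layer_L2: "f \<in> layer n \<Longrightarrow> f \<in> L2 M"
  using layer_steps steps_L2 by blast

lemma steps_subset_lower: "m < n \<Longrightarrow> steps m \<subseteq> lower_steps n"
  unfolding lower_steps_def using steps_mono[of m "n - 1"] by (cases n) auto

lemma layer_perp_steps: "f \<in> layer n \<Longrightarrow> m < n \<Longrightarrow> g \<in> steps m \<Longrightarrow> L2_inner M f g = 0"
  unfolding layer_def L2_perp_def using steps_subset_lower[of m n] by blast

lemma layers_perp:
  assumes "f \<in> layer m" "g \<in> layer n" "m \<noteq> n"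
  shows "L2_inner M f g = 0"
proof (cases "m < n")
  case True
  then show ?thesis
    using layer_perp_steps[OF assms(2) True layer_steps[OF assms(1)]]
    by (subst L2_inner_commute) simp
next
  case False
  then show ?thesis using layer_perp_steps[OF assms(1) _ layer_steps[OF assms(2)]] assms(3) by simp
qed

lemma layer_0: "layer 0 = steps 0"
proof -
  have "L2_inner M f g = 0" if "f \<in> L2 M" "g \<in> L2 M" "AE x in M. g x = 0" for f g
    using L2_inner_cong_AE[OF that(1,2) that(1) L2_zero _ that(3)] by (simp add: L2_inner_zero_right)
  then show ?thesis
    unfolding layer_def lower_steps_def L2_perp_def by (auto dest: steps_L2)
qed

lemma layer_Suc_diff:
  assumes "f \<in> steps (Suc n)"
  shows "(\<lambda>x. f x - avg n f x) \<in> layer (Suc n)"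
  unfolding layer_def lower_steps_def L2_perp_def
  using assms avg_perp[of f _ n] steps_diff[of f "Suc n" "avg n f"] steps_L2[OF assms]
    avg_steps[of n f] steps_Suc[of n]
  by (auto intro: L2_diff avg_L2)

lemma zero_layer: "(\<lambda>x. 0) \<in> layer n"
  using steps_sum[of "\<lambda>_. 0" n] by (simp add: layer_def L2_perp_def L2_zero L2_inner_zero_left)

lemma avg_layer_below:
  assumes f: "f \<in> layer k" and "n < k"
  shows "AE x in M. avg n f x = 0"
proof (rule avg_unique)
  show "(\<lambda>x. 0) \<in> steps n" using steps_sum[of "\<lambda>_. 0" n] by simp
  show "L2_inner M (\<lambda>x. f x - 0) h = 0" if "h \<in> steps n" for h
    using layer_perp_steps[OF f \<open>n < k\<close> that] by simp
qed (rule layer_L2[OF f])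

lemma eigenvector_number_op:
  assumes f: "f \<in> layer k"
  shows "(f, \<lambda>x. complex_of_real (real k) * f x) \<in> number_op"
proof -
  define u where "u n = (if n = k then f else (\<lambda>x. 0))" for n
  have sums: "L2_sums M (\<lambda>n x. z n * u n x) (\<lambda>x. z k * f x)" for z :: "nat \<Rightarrow> complex"
  proof -
    have "(\<Sum>n<N. z n * u n x) = z k * f x" if "k < N" for N x
    proof -
      have "(\<Sum>n<N. z n * u n x) = (\<Sum>n<N. if n = k then z k * f x else 0)"
        by (intro sum.cong) (auto simp: u_def)
      then show ?thesis using that by simp
    qed
    then have "eventually (\<lambda>N. L2_norm M (\<lambda>x. z k * f x - (\<Sum>n<N. z n * u n x)) = 0) sequentially"
      by (intro eventually_sequentiallyI[of "Suc k"]) (simp add: L2_norm_def)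
    then show ?thesis
      using layer_L2[OF f] by (auto simp: L2_sums_def L2_scale intro: tendsto_eventually)
  qed
  have "u n \<in> layer n" for n using f zero_layer by (simp add: u_def)
  moreover have "summable (\<lambda>n. (real n * L2_norm M (u n))\<^sup>2)"
    by (rule summable_finite[of "{k}"]) (auto simp: u_def L2_norm_def)
  ultimately show ?thesis
    unfolding number_op_def using sums[of "\<lambda>_. 1"] sums[of of_nat] by auto
qed

text \<open>Pairing \<open>f = \<Sum>\<^sub>n u\<^sub>n\<close> and \<open>l f = \<Sum>\<^sub>n n u\<^sub>n\<close> with \<open>u\<^sub>k\<close> gives \<open>l \<parallel>u\<^sub>k\<parallel>\<^sup>2 = k \<parallel>u\<^sub>k\<parallel>\<^sup>2\<close>, so \<open>u\<^sub>k\<close> is null unless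
  \<open>l = k\<close>.\<close>

lemma number_op_eigenvectorD:
  assumes "(f, \<lambda>x. complex_of_real l * f x) \<in> number_op"
  shows "f \<in> L2 M"
    and "(AE x in M. f x = 0) \<or> (\<exists>k u. l = real k \<and> u \<in> layer k \<and> (AE x in M. f x = u x))"
proof -
  obtain u where u: "\<And>n. u n \<in> layer n" and sf: "L2_sums M u f"
    and sg: "L2_sums M (\<lambda>n x. of_nat n * u n x) (\<lambda>x. complex_of_real l * f x)"
    using assms unfolding number_op_def by blast
  have uL: "u n \<in> L2 M" for n using layer_L2[OF u] .
  show f: "f \<in> L2 M" using sf by (simp add: L2_sums_def)
  have coeff: "L2_inner M f (u k) = L2_inner M (u k) (u k)"
      "complex_of_real l * L2_inner M f (u k) = of_nat k * L2_inner M (u k) (u k)" for k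
  proof -
    have single: "(\<lambda>n. z n * L2_inner M (u n) (u k)) sums (z k * L2_inner M (u k) (u k))" for z
      using sums_finite[of "{k}" "\<lambda>n. z n * L2_inner M (u n) (u k)"] layers_perp[OF u u] by simp
    show "L2_inner M f (u k) = L2_inner M (u k) (u k)"
      using L2_sums_inner[OF sf uL uL[of k]] single[of "\<lambda>_. 1"] sums_unique2 by simp blast
    show "complex_of_real l * L2_inner M f (u k) = of_nat k * L2_inner M (u k) (u k)"
      using L2_sums_inner[OF sg L2_scale[OF uL] uL[of k]] single[of of_nat] sums_unique2
      unfolding L2_inner_scale_left by blast
  qed
  have zero: "AE x in M. u k x = 0" if "l \<noteq> real k" for k
  proof -
    have "complex_of_real (l - real k) * L2_inner M (u k) (u k) = 0"
      using coeff[of k] by (simp add: left_diff_distrib)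
    moreover have "complex_of_real (l - real k) \<noteq> 0"
      using that unfolding of_real_eq_0_iff by simp
    ultimately have "L2_inner M (u k) (u k) = 0" by (metis mult_eq_0_iff)
    then have "L2_norm M (u k) = 0" by (simp add: L2_inner_self)
    then show ?thesis using L2_norm_eq_0_iff[OF uL] by simp
  qed
  have lim: "(\<lambda>N. L2_norm M (\<lambda>x. f x - (\<Sum>n<N. u n x))) \<longlonglongrightarrow> 0"
    using sf by (simp add: L2_sums_def)
  show "(AE x in M. f x = 0) \<or> (\<exists>k u. l = real k \<and> u \<in> layer k \<and> (AE x in M. f x = u x))"
  proof -
    \<comment> \<open>The only component that can survive, or zero if the eigenvalue is not a natural number.\<close>
    define v where "v = (if \<exists>k. l = real k then u (nat \<lfloor>l\<rfloor>) else (\<lambda>x. 0))"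
    have v: "v \<in> L2 M" using uL by (simp add: v_def L2_zero)
    have part: "L2_norm M (\<lambda>x. f x - (\<Sum>n<N. u n x)) = L2_norm M (\<lambda>x. f x - v x)"
      if N: "nat \<lfloor>l\<rfloor> < N" for N
    proof (rule L2_norm_cong_AE)
      have "AE x in M. \<forall>n\<in>{n. l \<noteq> real n}. u n x = 0"
        using zero by (subst AE_ball_countable) auto
      then show "AE x in M. f x - (\<Sum>n<N. u n x) = f x - v x"
      proof eventually_elim
        fix x assume z: "\<forall>n\<in>{n. l \<noteq> real n}. u n x = 0"
        have "(\<Sum>n<N. u n x) = (\<Sum>n<N. if n = nat \<lfloor>l\<rfloor> then v x else 0)"
          using z by (intro sum.cong) (auto simp: v_def)
        then show "f x - (\<Sum>n<N. u n x) = f x - v x" using N by simp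
      qed
    qed (use f v uL in \<open>auto intro!: L2_diff L2_sum\<close>)
    have "eventually (\<lambda>N. L2_norm M (\<lambda>x. f x - (\<Sum>n<N. u n x)) = L2_norm M (\<lambda>x. f x - v x)) sequentially"
      using part by (intro eventually_sequentiallyI[of "Suc (nat \<lfloor>l\<rfloor>)"]) simp
    then have "(\<lambda>N. L2_norm M (\<lambda>x. f x - (\<Sum>n<N. u n x))) \<longlonglongrightarrow> L2_norm M (\<lambda>x. f x - v x)"
      by (rule tendsto_eventually)
    from LIMSEQ_unique[OF this lim] have fv: "AE x in M. f x = v x"
      by (rule L2_eq_AE_if_norm_diff_0[OF f v])
    show ?thesis
    proof (cases "\<exists>k. l = real k")
      case True
      then obtain k where "l = real k" "v = u k" by (auto simp: v_def)
      then show ?thesis using fv u[of k] by blast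
    next
      case False
      then show ?thesis using fv by (simp add: v_def)
    qed
  qed
qed

section \<open>Weighted sums of averaging projections\<close>

text \<open>For \<open>a n = \<lambda> n - \<lambda> (n + 1)\<close> this is, by summation by parts, the operator with eigenvalue \<open>\<lambda> k\<close> on the
  \<open>k\<close>-th layer. Written with the averages themselves, which are positive contractions, and with
  non-negative weights, the series is easy to control pointwise.\<close>

definition weighted_avg :: "(nat \<Rightarrow> real) \<Rightarrow> ('b \<Rightarrow> complex) \<Rightarrow> 'b \<Rightarrow> complex" where
  "weighted_avg a f x = (\<Sum>n. complex_of_real (a n) * avg n f x)"

end

text \<open>The Cauchy-Schwarz inequality for series, with the weight split as \<open>a = \<surd>a \<surd>a\<close>.\<close>

lemma weighted_Cauchy_Schwarz:
  fixes a :: "nat \<Rightarrow> real" and z :: "nat \<Rightarrow> complex"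
  assumes a: "\<And>n. a n \<ge> 0" "summable a" and az: "summable (\<lambda>n. a n * (cmod (z n))\<^sup>2)"
  shows "summable (\<lambda>n. cmod (complex_of_real (a n) * z n))"
    and "(cmod (\<Sum>n. complex_of_real (a n) * z n))\<^sup>2 \<le> suminf a * (\<Sum>n. a n * (cmod (z n))\<^sup>2)"
proof -
  have le: "t \<le> 1 + t\<^sup>2" for t :: real
    using sum_squares_bound[of 1 t] zero_le_power2[of t] unfolding power_one by linarith
  show abs: "summable (\<lambda>n. cmod (complex_of_real (a n) * z n))"
  proof (rule summable_comparison_test'[OF summable_add[OF a(2) az], of 0])
    fix n
    show "norm (cmod (complex_of_real (a n) * z n)) \<le> a n + a n * (cmod (z n))\<^sup>2"
      using mult_left_mono[OF le[of "cmod (z n)"] a(1)[of n]] a(1)[of n]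
      by (simp add: norm_mult distrib_left power_mult_distrib)
  qed
  have "(\<Sum>n<N. cmod (complex_of_real (a n) * z n))\<^sup>2 \<le> suminf a * (\<Sum>n. a n * (cmod (z n))\<^sup>2)" for N
  proof -
    have "(\<Sum>n<N. cmod (complex_of_real (a n) * z n))\<^sup>2 =
        (\<Sum>n<N. sqrt (a n) * (sqrt (a n) * cmod (z n)))\<^sup>2"
      using a(1) by (simp add: norm_mult mult.assoc[symmetric])
    also have "\<dots> \<le> (\<Sum>n<N. (sqrt (a n))\<^sup>2) * (\<Sum>n<N. (sqrt (a n) * cmod (z n))\<^sup>2)"
      by (rule Cauchy_Schwarz_ineq_sum)
    also have "\<dots> = (\<Sum>n<N. a n) * (\<Sum>n<N. a n * (cmod (z n))\<^sup>2)"
      using a(1) by (simp add: power_mult_distrib)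
    also have "\<dots> \<le> suminf a * (\<Sum>n. a n * (cmod (z n))\<^sup>2)"
      using a az by (intro mult_mono sum_le_suminf sum_nonneg suminf_nonneg) auto
    finally show ?thesis .
  qed
  moreover have "(\<lambda>N. (\<Sum>n<N. cmod (complex_of_real (a n) * z n))\<^sup>2) \<longlonglongrightarrow>
      (\<Sum>n. cmod (complex_of_real (a n) * z n))\<^sup>2"
    by (intro tendsto_power summable_LIMSEQ abs)
  ultimately have "(\<Sum>n. cmod (complex_of_real (a n) * z n))\<^sup>2 \<le>
      suminf a * (\<Sum>n. a n * (cmod (z n))\<^sup>2)"
    by (intro LIMSEQ_le_const2[of _ _ "suminf a * (\<Sum>n. a n * (cmod (z n))\<^sup>2)"]) auto
  moreover have "(cmod (\<Sum>n. complex_of_real (a n) * z n))\<^sup>2 \<le>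
      (\<Sum>n. cmod (complex_of_real (a n) * z n))\<^sup>2"
    by (intro power_mono summable_norm abs) auto
  ultimately show "(cmod (\<Sum>n. complex_of_real (a n) * z n))\<^sup>2 \<le>
      suminf a * (\<Sum>n. a n * (cmod (z n))\<^sup>2)" by linarith
qed

context refining_partitions begin

context
  fixes a :: "nat \<Rightarrow> real"
  assumes a: "\<And>n. a n \<ge> 0" "summable a"
begin

text \<open>The integrals of the terms are at most \<open>a n \<parallel>f\<parallel>\<^sup>2\<close>, since averaging is contractive, and so have a
  finite sum. By monotone convergence the series of squares is finite almost everywhere.\<close>

lemma weighted_squares:
  assumes f: "f \<in> L2 M"
  shows "AE x in M. summable (\<lambda>n. a n * (cmod (avg n f x))\<^sup>2)"
    and "integrable M (\<lambda>x. \<Sum>n. a n * (cmod (avg n f x))\<^sup>2)"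
    and "(\<integral>x. (\<Sum>n. a n * (cmod (avg n f x))\<^sup>2) \<partial>M) \<le> suminf a * (L2_norm M f)\<^sup>2"
proof -
  let ?g = "\<lambda>n x. a n * (cmod (avg n f x))\<^sup>2"
  have int: "integrable M (?g n)" for n
    by (intro integrable_mult_right L2_square_integrable avg_L2)
  have val: "(\<integral>x. ?g n x \<partial>M) = a n * (L2_norm M (avg n f))\<^sup>2" for n
    by (simp add: L2_norm_def)
  have le: "a n * (L2_norm M (avg n f))\<^sup>2 \<le> a n * (L2_norm M f)\<^sup>2" for n
    by (intro mult_left_mono power_mono avg_norm_le f L2_norm_nonneg a)
  have majorant: "summable (\<lambda>n. a n * (L2_norm M f)\<^sup>2)" using a by (intro summable_mult2)
  have sum: "summable (\<lambda>n. a n * (L2_norm M (avg n f))\<^sup>2)"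
    using le a(1) by (intro summable_comparison_test'[OF majorant, of 0]) simp
  have nn: "(\<integral>\<^sup>+x. ennreal (?g n x) \<partial>M) = ennreal (a n * (L2_norm M (avg n f))\<^sup>2)" for n
    unfolding val[symmetric] using a(1) by (intro nn_integral_eq_integral int) auto
  \<comment> \<open>Non-negative extended integrals commute with sums before any convergence is known.\<close>
  have "(\<integral>\<^sup>+x. (\<Sum>n. ennreal (?g n x)) \<partial>M) = (\<Sum>n. \<integral>\<^sup>+x. ennreal (?g n x) \<partial>M)"
    using borel_measurable_integrable[OF int] by (intro nn_integral_suminf) auto
  also have "\<dots> = (\<Sum>n. ennreal (a n * (L2_norm M (avg n f))\<^sup>2))"
    by (simp only: nn)
  also have "\<dots> \<noteq> \<infinity>"
    using sum a(1) ennreal_suminf_neq_top by simp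
  finally have fin: "(\<integral>\<^sup>+x. (\<Sum>n. ennreal (?g n x)) \<partial>M) \<noteq> \<infinity>" .
  have "AE x in M. (\<Sum>n. ennreal (?g n x)) \<noteq> \<infinity>"
    by (intro nn_integral_PInf_AE fin borel_measurable_suminf_order measurable_compose[OF _ measurable_ennreal]
        borel_measurable_integrable[OF int])
  then show AE: "AE x in M. summable (\<lambda>n. ?g n x)"
    by eventually_elim (use a(1) in \<open>auto intro!: summable_suminf_not_top\<close>)
  have ng: "norm (?g n x) = ?g n x" for n x
    using a(1) by simp
  have AE': "AE x in M. summable (\<lambda>n. norm (?g n x))"
    using AE by (simp only: ng)
  have sum': "summable (\<lambda>n. \<integral>x. norm (?g n x) \<partial>M)"
    using sum by (simp only: ng val)
  show "integrable M (\<lambda>x. \<Sum>n. ?g n x)"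
    by (rule integrable_suminf[OF int AE' sum'])
  have "(\<integral>x. (\<Sum>n. ?g n x) \<partial>M) = (\<Sum>n. a n * (L2_norm M (avg n f))\<^sup>2)"
    by (simp only: integral_suminf[OF int AE' sum'] val)
  also have "\<dots> \<le> (\<Sum>n. a n * (L2_norm M f)\<^sup>2)"
    by (intro suminf_le le sum majorant)
  also have "\<dots> = suminf a * (L2_norm M f)\<^sup>2"
    using a(2) by (rule suminf_mult2[symmetric])
  finally show "(\<integral>x. (\<Sum>n. ?g n x) \<partial>M) \<le> suminf a * (L2_norm M f)\<^sup>2" .
qed

lemma weighted_avg_summable:
  assumes f: "f \<in> L2 M"
  shows "AE x in M. summable (\<lambda>n. cmod (complex_of_real (a n) * avg n f x))"
  using weighted_squares(1)[OF f]
  by eventually_elim (rule weighted_Cauchy_Schwarz(1)[OF a])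

lemma weighted_avg_measurable: "weighted_avg a f \<in> borel_measurable M"
proof -
  have [measurable]: "avg n f \<in> borel_measurable M" for n
    using avg_L2 by (rule L2_measurable)
  show ?thesis unfolding weighted_avg_def[abs_def] by measurable
qed

lemma weighted_avg_bounded:
  assumes f: "f \<in> L2 M"
  shows "weighted_avg a f \<in> L2 M" and "L2_norm M (weighted_avg a f) \<le> suminf a * L2_norm M f"
proof -
  let ?G = "\<lambda>x. suminf a * (\<Sum>n. a n * (cmod (avg n f x))\<^sup>2)"
  have le: "AE x in M. (cmod (weighted_avg a f x))\<^sup>2 \<le> ?G x"
    using weighted_squares(1)[OF f] unfolding weighted_avg_def
    by eventually_elim (rule weighted_Cauchy_Schwarz(2)[OF a])
  have G: "integrable M ?G" by (intro integrable_mult_right weighted_squares f)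
  have "integrable M (\<lambda>x. (cmod (weighted_avg a f x))\<^sup>2)"
  proof (rule Bochner_Integration.integrable_bound[OF G])
    show "(\<lambda>x. (cmod (weighted_avg a f x))\<^sup>2) \<in> borel_measurable M"
      using weighted_avg_measurable by measurable
    show "AE x in M. norm ((cmod (weighted_avg a f x))\<^sup>2) \<le> norm (?G x)"
      using le by eventually_elim simp
  qed
  then show T: "weighted_avg a f \<in> L2 M"
    using weighted_avg_measurable by (simp add: L2_def)
  have A: "suminf a \<ge> 0" using a by (intro suminf_nonneg)
  show "L2_norm M (weighted_avg a f) \<le> suminf a * L2_norm M f"
  proof (rule power2_le_imp_le)
    have "(L2_norm M (weighted_avg a f))\<^sup>2 = (\<integral>x. (cmod (weighted_avg a f x))\<^sup>2 \<partial>M)"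
      by (simp add: L2_norm_def)
    also have "\<dots> \<le> (\<integral>x. ?G x \<partial>M)"
      by (intro integral_mono_AE L2_square_integrable T G le)
    also have "\<dots> \<le> suminf a * (suminf a * (L2_norm M f)\<^sup>2)"
      using weighted_squares(3)[OF f] A by (simp add: mult_left_mono)
    finally show "(L2_norm M (weighted_avg a f))\<^sup>2 \<le> (suminf a * L2_norm M f)\<^sup>2"
      by (simp add: power2_eq_square mult_ac)
  qed (intro mult_nonneg_nonneg A L2_norm_nonneg)
qed

text \<open>Integration term by term; the integrals of the absolute values are dominated by
  \<open>a n (\<parallel>f\<parallel>\<^sup>2 + \<parallel>g\<parallel>\<^sup>2)\<close>.\<close>

lemma weighted_avg_inner:
  assumes f: "f \<in> L2 M" and g: "g \<in> L2 M"
  shows "(\<lambda>n. complex_of_real (a n) * L2_inner M (avg n f) g) sums L2_inner M (weighted_avg a f) g"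
proof -
  let ?h = "\<lambda>n x. complex_of_real (a n) * avg n f x * cnj (g x)"
  have int: "integrable M (?h n)" for n
    unfolding mult.assoc by (intro integrable_mult_right L2_inner_integrable avg_L2 g)
  have AE: "AE x in M. summable (\<lambda>n. norm (?h n x))"
    using weighted_avg_summable[OF f]
    by eventually_elim (simp only: norm_mult[of _ "cnj _"] summable_mult2)
  have majorant: "summable (\<lambda>n. a n * ((L2_norm M f)\<^sup>2 + (L2_norm M g)\<^sup>2))"
    using a by (intro summable_mult2)
  have sum: "summable (\<lambda>n. \<integral>x. norm (?h n x) \<partial>M)"
  proof (rule summable_comparison_test'[OF majorant, of 0])
    fix n
    have "(\<integral>x. norm (?h n x) \<partial>M) = a n * (\<integral>x. cmod (avg n f x) * cmod (g x) \<partial>M)"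
      using a(1)[of n] by (simp add: norm_mult mult.assoc)
    also have "\<dots> \<le> a n * ((L2_norm M (avg n f))\<^sup>2 + (L2_norm M g)\<^sup>2)"
      by (intro mult_left_mono L2_mult_integrable avg_L2 g a)
    also have "\<dots> \<le> a n * ((L2_norm M f)\<^sup>2 + (L2_norm M g)\<^sup>2)"
      by (intro mult_left_mono add_right_mono power_mono avg_norm_le f L2_norm_nonneg a)
    finally show "norm (\<integral>x. norm (?h n x) \<partial>M) \<le> a n * ((L2_norm M f)\<^sup>2 + (L2_norm M g)\<^sup>2)"
      by simp
  qed
  have "(\<integral>x. (\<Sum>n. ?h n x) \<partial>M) = L2_inner M (weighted_avg a f) g"
    unfolding L2_inner_def
  proof (rule integral_cong_AE)
    show "AE x in M. (\<Sum>n. ?h n x) = weighted_avg a f x * cnj (g x)"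
      using weighted_avg_summable[OF f] unfolding weighted_avg_def
      by eventually_elim (rule suminf_mult2[symmetric, OF summable_norm_cancel])
    show "(\<lambda>x. \<Sum>n. ?h n x) \<in> borel_measurable M"
      by (rule borel_measurable_integrable, rule integrable_suminf[OF int AE sum])
    show "(\<lambda>x. weighted_avg a f x * cnj (g x)) \<in> borel_measurable M"
      by (rule borel_measurable_integrable, rule L2_inner_integrable[OF weighted_avg_bounded(1)[OF f] g])
  qed
  with sums_integral[OF int AE sum] show ?thesis
    by (simp add: L2_inner_def mult.assoc)
qed

lemma weighted_avg_bounded_op: "bounded_op M (weighted_avg a)"
  unfolding bounded_op_def
proof (intro conjI ballI allI exI)
  fix f g :: "'b \<Rightarrow> complex" and b c :: complex assume f: "f \<in> L2 M" and g: "g \<in> L2 M"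
  have lin: "avg n (\<lambda>y. b * f y + c * g y) x = b * avg n f x + c * avg n g x" for n x
  proof -
    have "L2_inner M (\<lambda>y. b * f y + c * g y) (indicator A) =
        b * L2_inner M f (indicator A) + c * L2_inner M g (indicator A)" if "A \<in> cells n" for A
      using f g cells_L2[OF that] by (simp add: L2_inner_add_left L2_inner_scale_left L2_scale)
    then show ?thesis
      unfolding avg_def sum_distrib_left sum.distrib[symmetric]
      by (intro sum.cong) (simp_all add: add_divide_distrib distrib_right mult.assoc)
  qed
  show "AE x in M. weighted_avg a (\<lambda>y. b * f y + c * g y) x =
      b * weighted_avg a f x + c * weighted_avg a g x"
    using weighted_avg_summable[OF f] weighted_avg_summable[OF g]
  proof eventually_elim
    case (elim x)
    note sf = summable_norm_cancel[OF elim(1)] and sg = summable_norm_cancel[OF elim(2)]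
    show ?case
      unfolding weighted_avg_def lin suminf_mult[OF sf, symmetric] suminf_mult[OF sg, symmetric]
        suminf_add[OF summable_mult[OF sf] summable_mult[OF sg]]
      by (simp add: algebra_simps)
  qed
qed (auto intro: weighted_avg_bounded)

lemma weighted_avg_symmetric:
  assumes "f \<in> L2 M" "g \<in> L2 M"
  shows "L2_inner M (weighted_avg a f) g = L2_inner M f (weighted_avg a g)"
proof -
  have "(\<lambda>n. cnj (complex_of_real (a n) * L2_inner M (avg n g) f)) sums
      cnj (L2_inner M (weighted_avg a g) f)"
    using weighted_avg_inner[OF assms(2,1)] by (simp only: sums_cnj)
  also have "(\<lambda>n. cnj (complex_of_real (a n) * L2_inner M (avg n g) f)) =
      (\<lambda>n. complex_of_real (a n) * L2_inner M (avg n f) g)"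
    by (simp add: avg_symmetric[OF assms] L2_inner_commute[of M f])
  finally show ?thesis
    using sums_unique2[OF weighted_avg_inner[OF assms]]
    by (simp add: L2_inner_commute[of M f])
qed

lemma weighted_avg_quadratic_form:
  assumes "f \<in> L2 M"
  shows "(\<lambda>n. a n * (L2_norm M (avg n f))\<^sup>2) sums Re (L2_inner M (weighted_avg a f) f)"
    and "Im (L2_inner M (weighted_avg a f) f) = 0"
    and "Re (L2_inner M (weighted_avg a f) f) \<ge> 0"
proof -
  have s: "(\<lambda>n. complex_of_real (a n * (L2_norm M (avg n f))\<^sup>2)) sums L2_inner M (weighted_avg a f) f"
    using weighted_avg_inner[OF assms assms] by (simp add: avg_norm_square[OF assms])
  show *: "(\<lambda>n. a n * (L2_norm M (avg n f))\<^sup>2) sums Re (L2_inner M (weighted_avg a f) f)"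
    using sums_Re[OF s] by simp
  show "Im (L2_inner M (weighted_avg a f) f) = 0"
    using sums_unique2[OF sums_Im[OF s] sums_zero[THEN sums_cong[THEN iffD1, rotated]]] by simp
  show "Re (L2_inner M (weighted_avg a f) f) \<ge> 0"
    using a(1) by (intro sums_le[OF _ sums_zero *]) simp
qed

text \<open>The operator is symmetric and positive, so it is its own absolute value. Its diagonal sums over
  finite parts of an orthonormal basis are bounded by exchanging a finite sum with the series and
  applying \<open>avg_trace_le\<close> to each term.\<close>

lemma weighted_avg_trace_class:
  assumes trace: "summable (\<lambda>n. a n * real (card (cells n)))"
  shows "trace_class M (weighted_avg a)"
proof -
  have abs: "is_abs_op M (weighted_avg a) (weighted_avg a)"
    unfolding is_abs_op_def positive_op_def is_adjoint_def
    using weighted_avg_bounded_op weighted_avg_symmetric weighted_avg_quadratic_form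
    by (intro conjI exI[of _ "weighted_avg a"]) auto
  obtain E where E: "L2_onb M E" using onb_exists by blast
  note on = L2_onb_orthonormal[OF E]
  have EL: "e \<in> L2 M" if "e \<in> E" for e using that on by (auto simp: L2_orthonormal_def)
  have "(\<lambda>e. Re (L2_inner M (weighted_avg a e) e)) summable_on E"
  proof (rule nonneg_bdd_above_summable_on)
    show "Re (L2_inner M (weighted_avg a e) e) \<ge> 0" if "e \<in> E" for e
      using weighted_avg_quadratic_form(3)[OF EL[OF that]] .
    show "bdd_above (sum (\<lambda>e. Re (L2_inner M (weighted_avg a e) e)) ` {F. F \<subseteq> E \<and> finite F})"
    proof (rule bdd_aboveI2)
      fix F assume "F \<in> {F. F \<subseteq> E \<and> finite F}"
      then have F: "F \<subseteq> E" "finite F" by auto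
      have s: "(\<lambda>n. \<Sum>e\<in>F. a n * (L2_norm M (avg n e))\<^sup>2) sums
          (\<Sum>e\<in>F. Re (L2_inner M (weighted_avg a e) e))"
        using F EL by (intro sums_sum weighted_avg_quadratic_form) auto
      have le: "(\<Sum>e\<in>F. a n * (L2_norm M (avg n e))\<^sup>2) \<le> a n * real (card (cells n))" for n
        unfolding sum_distrib_left[symmetric]
        by (intro mult_left_mono avg_trace_le L2_orthonormal_subset[OF on] F a)
      show "(\<Sum>e\<in>F. Re (L2_inner M (weighted_avg a e) e)) \<le>
          (\<Sum>n. a n * real (card (cells n)))"
        by (rule sums_le[OF le s summable_sums[OF trace]])
    qed
  qed
  then show ?thesis
    unfolding trace_class_def
    by (intro conjI exI[of _ "weighted_avg a"] exI[of _ E] weighted_avg_bounded_op abs E)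
qed

text \<open>On the \<open>k\<close>-th layer the averages of level below \<open>k\<close> vanish and the others are the identity, so only the
  tail of the weights is left.\<close>

lemma weighted_avg_layer:
  assumes f: "f \<in> layer k"
  shows "AE x in M. weighted_avg a f x = complex_of_real (\<Sum>n. a (n + k)) * f x"
proof -
  have "AE x in M. avg n f x = (if n < k then 0 else f x)" for n
    using avg_layer_below[OF f, of n] avg_of_steps[of f n] layer_steps[OF f] steps_mono[of k n]
    by (cases "n < k") auto
  then have "AE x in M. \<forall>n. avg n f x = (if n < k then 0 else f x)"
    by (simp add: AE_all_countable)
  then show ?thesis
  proof eventually_elim
    fix x assume x: "\<forall>n. avg n f x = (if n < k then 0 else f x)"
    have "(\<lambda>n. complex_of_real (a (n + k)) * f x) sums (complex_of_real (\<Sum>n. a (n + k)) * f x)"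
      using a(2) by (intro sums_mult2 sums_of_real summable_sums) simp
    then have "(\<lambda>n. complex_of_real (a (n + k)) * avg (n + k) f x) sums
        (complex_of_real (\<Sum>n. a (n + k)) * f x)"
      using x by simp
    then have "(\<lambda>n. complex_of_real (a n) * avg n f x) sums
        (complex_of_real (\<Sum>n. a (n + k)) * f x)"
      using x by (subst (asm) sums_iff_shift) simp
    then show "weighted_avg a f x = complex_of_real (\<Sum>n. a (n + k)) * f x"
      unfolding weighted_avg_def by (rule sums_unique[symmetric])
  qed
qed

end

text \<open>Weights that telescope to \<open>(1 + k\<^sup>2)\<^sup>-\<^sup>s\<^sup>/\<^sup>2\<close> on the \<open>k\<close>-th layer turn the weighted average into the
  required function of the number operator.\<close>

lemma s_summable_number_op:
  assumes s: "s > 0"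
    and trace: "summable (\<lambda>n. ((1 + (real n)\<^sup>2) powr (- s / 2) - (1 + (real (Suc n))\<^sup>2) powr (- s / 2)) *
      real (card (cells n)))"
  shows "s_summable M number_op s"
proof -
  define lam where "lam n = (1 + (real n)\<^sup>2) powr (- s / 2)" for n
  define a where "a n = lam n - lam (Suc n)" for n
  have lam0: "lam \<longlonglongrightarrow> 0"
    unfolding lam_def using s
    by (intro tendsto_neg_powr filterlim_tendsto_add_at_top[OF tendsto_const]
        filterlim_pow_at_top filterlim_real_sequentially) auto
  have a_nonneg: "a n \<ge> 0" for n
    unfolding a_def lam_def using s by (auto intro!: powr_mono2' power_mono add_pos_nonneg)
  have tail: "(\<lambda>n. a (n + k)) sums lam k" for k
    using telescope_sums'[OF LIMSEQ_ignore_initial_segment[OF lam0, of k]] by (simp add: a_def)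
  have a: "summable a" using tail[of 0] by (simp add: sums_iff)
  have "AE x in M. weighted_avg a f x = complex_of_real ((1 + l\<^sup>2) powr (- s / 2)) * f x"
    if fl: "(f, \<lambda>x. complex_of_real l * f x) \<in> number_op" for f l
  proof -
    note f = number_op_eigenvectorD(1)[OF fl]
    from number_op_eigenvectorD(2)[OF fl] show ?thesis
    proof (elim disjE exE conjE)
      assume z: "AE x in M. f x = 0"
      have "AE x in M. weighted_avg a f x = weighted_avg a (\<lambda>x. 0) x"
        by (rule bounded_op_cong_AE[OF weighted_avg_bounded_op[OF a_nonneg a] f L2_zero z])
      moreover have "weighted_avg a (\<lambda>x. 0) x = 0" for x
        by (simp add: weighted_avg_def avg_def L2_inner_zero_left)
      ultimately show ?thesis using z by auto
    next
      fix k u assume l: "l = real k" and u: "u \<in> layer k" and eq: "AE x in M. f x = u x"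
      have "AE x in M. weighted_avg a f x = weighted_avg a u x"
        by (rule bounded_op_cong_AE[OF weighted_avg_bounded_op[OF a_nonneg a] f layer_L2[OF u] eq])
      moreover have "(\<Sum>n. a (n + k)) = (1 + l\<^sup>2) powr (- s / 2)"
        using sums_unique[OF tail[of k]] by (simp add: lam_def l)
      ultimately show ?thesis
        using weighted_avg_layer[OF a_nonneg a u] eq by auto
    qed
  qed
  then have "is_op_function M number_op (\<lambda>l. (1 + l\<^sup>2) powr (- s / 2)) (weighted_avg a)"
    unfolding is_op_function_def using weighted_avg_bounded_op[OF a_nonneg a] by blast
  moreover have "trace_class M (weighted_avg a)"
    using trace by (intro weighted_avg_trace_class a_nonneg a) (simp add: a_def lam_def)
  ultimately show ?thesis unfolding s_summable_def by blast
qed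

section \<open>Lower bound for the trace\<close>

text \<open>Step functions of level \<open>n + 1\<close> split as an element of the layer \<open>n + 1\<close> plus a step function of level
  \<open>n\<close>. The factors 1 give the sum the shape in which \<open>bounded_op\<close> states linearity.\<close>

lemma layers_induct [consumes 1, case_names bottom extend]:
  assumes "h \<in> steps n"
    and bottom: "\<And>h. h \<in> layer 0 \<Longrightarrow> Q 0 h"
    and extend: "\<And>n d h. d \<in> layer (Suc n) \<Longrightarrow> h \<in> steps n \<Longrightarrow> Q n h \<Longrightarrow>
      Q (Suc n) (\<lambda>x. 1 * d x + 1 * h x)"
  shows "Q n h"
  using assms(1)
proof (induction n arbitrary: h)
  case 0
  then show ?case using bottom layer_0 by simp
next
  case (Suc n)
  from extend[OF layer_Suc_diff[OF Suc.prems] avg_steps[of n h] Suc.IH[OF avg_steps]]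
  show ?case by simp
qed

text \<open>The layers span all step functions, and these are dense.\<close>

lemma steps_total_perp:
  assumes v: "v \<in> L2 M" and perp: "\<And>k d. d \<in> layer k \<Longrightarrow> L2_inner M d v = 0"
  shows "AE x in M. v x = 0"
proof -
  have "L2_inner M h v = 0" if "h \<in> steps n" for h n
    using that
  proof (induction rule: layers_induct)
    case (extend n d h)
    then show ?case
      using v perp[OF extend(1)] layer_L2[OF extend(1)] steps_L2[OF extend(2)]
      by (simp add: L2_inner_add_left)
  qed (rule perp)
  moreover have "indicator A \<in> steps n" if "A \<in> cells n" for A n
  proof -
    have "(\<lambda>x. \<Sum>B\<in>cells n. (if B = A then 1 else 0) * indicator B x) = (indicator A :: 'b \<Rightarrow> complex)"
      using that finite_cells by (simp add: if_distrib[where f = "\<lambda>c. c * _"] cong: if_cong)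
    then show ?thesis using steps_sum[of "\<lambda>B. if B = A then 1 else 0" n] by simp
  qed
  ultimately have "{f \<in> L2 M. L2_inner M f v = 0} = L2 M"
    by (intro closed_subspace_total L2_closed_subspace_perp v) (auto intro: cells_L2)
  then have "L2_inner M v v = 0" using v by blast
  then show ?thesis using L2_norm_eq_0_iff[OF v] by (simp add: L2_inner_self)
qed

text \<open>The trace of the absolute value \<open>P\<close> dominates \<open>\<lambda>\<^sub>n\<close> times the trace of the projection onto the step
  functions of level \<open>n\<close>, and the latter trace is the number of cells.\<close>

lemma card_cells_bound_if_s_summable:
  assumes s: "s > 0" and summable: "s_summable M number_op s"
  shows "\<exists>K. \<forall>n. real (card (cells n)) * (1 + (real n)\<^sup>2) powr (- s / 2) \<le> K"
proof -
  define lam where "lam n = (1 + (real n)\<^sup>2) powr (- s / 2)" for n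
  have lam_pos: "lam n > 0" for n
    using zero_le_power2[of "real n"] unfolding lam_def powr_gt_zero by linarith
  have lam_mono: "lam (Suc n) \<le> lam n" for n
    unfolding lam_def using s by (auto intro!: powr_mono2' power_mono add_pos_nonneg)
  obtain T where op: "is_op_function M number_op (\<lambda>l. (1 + l\<^sup>2) powr (- s / 2)) T"
    and tr: "trace_class M T"
    using summable unfolding s_summable_def by blast
  have T: "bounded_op M T" using tr unfolding trace_class_def by blast
  obtain P E where abs: "is_abs_op M T P" and E: "L2_onb M E"
    and sum: "(\<lambda>e. Re (L2_inner M (P e) e)) summable_on E"
    using tr unfolding trace_class_def by (elim conjE exE)
  have pos: "positive_op M P" using abs unfolding is_abs_op_def by blast
  then have P: "bounded_op M P" and Ppos: "\<And>f. f \<in> L2 M \<Longrightarrow> Re (L2_inner M (P f) f) \<ge> 0"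
    by (auto simp: positive_op_def)
  obtain S where S_adj: "is_adjoint M T S"
    and PS: "\<And>f. f \<in> L2 M \<Longrightarrow> AE x in M. P (P f) x = S (T f) x"
    using abs unfolding is_abs_op_def by (elim conjE exE) blast
  have S: "bounded_op M S"
    and adj: "\<And>f g. f \<in> L2 M \<Longrightarrow> g \<in> L2 M \<Longrightarrow> L2_inner M (T f) g = L2_inner M f (S g)"
    using S_adj unfolding is_adjoint_def by blast+

  have T_layer: "AE x in M. T f x = complex_of_real (lam k) * f x" if "f \<in> layer k" for f k
    using op eigenvector_number_op[OF that] unfolding is_op_function_def lam_def by blast

  \<comment> \<open>The adjoint has the same eigenvectors: its values are tested against the layers, which span a dense subspace.\<close>
  have S_layer: "AE x in M. S f x = complex_of_real (lam k) * f x" if f: "f \<in> layer k" for f k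
  proof -
    let ?v = "\<lambda>x. S f x - complex_of_real (lam k) * f x"
    note fL = layer_L2[OF f]
    note Sf = bounded_opD(1)[OF S fL]
    have "AE x in M. ?v x = 0"
    proof (rule steps_total_perp)
      show "?v \<in> L2 M" by (intro L2_diff L2_scale Sf fL)
      fix j d assume d: "d \<in> layer j"
      note dL = layer_L2[OF d]
      have "L2_inner M d (S f) = L2_inner M (\<lambda>x. complex_of_real (lam j) * d x) f"
        unfolding adj[OF dL fL, symmetric]
        by (rule L2_inner_cong_AE[OF bounded_opD(1)[OF T dL] fL L2_scale[OF dL] fL T_layer[OF d]]) simp
      then have "L2_inner M d ?v = complex_of_real (lam j - lam k) * L2_inner M d f"
        using dL fL Sf
        by (simp add: L2_inner_diff_right L2_inner_scale_left L2_inner_scale_right L2_scale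
            left_diff_distrib)
      also have "\<dots> = 0" using layers_perp[OF d f] by (cases "j = k") auto
      finally show "L2_inner M d ?v = 0" .
    qed
    then show ?thesis by simp
  qed

  \<comment> \<open>From \<open>P\<^sup>2 f = \<lambda>\<^sup>2 f\<close>, the vector \<open>v = P f - \<lambda> f\<close> satisfies \<open>P v = - \<lambda> v\<close>, which positivity allows only for null \<open>v\<close>.\<close>
  have P_layer: "AE x in M. P f x = complex_of_real (lam k) * f x" if f: "f \<in> layer k" for f k
  proof -
    let ?l = "complex_of_real (lam k)"
    let ?v = "\<lambda>x. 1 * P f x + (- ?l) * f x"
    note fL = layer_L2[OF f]
    note Pf = bounded_opD(1)[OF P fL]
    have v: "?v \<in> L2 M" by (intro L2_lincomb Pf fL)
    have ST: "AE x in M. S (T f) x = S (\<lambda>y. ?l * f y + 0 * f y) x"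
      using T_layer[OF f]
      by (intro bounded_op_cong_AE[OF S bounded_opD(1)[OF T fL] L2_lincomb[OF fL fL]]) simp
    have Pv: "AE x in M. P ?v x = - ?l * ?v x"
      using bounded_opD(2)[OF P Pf fL, of 1 "- ?l"] PS[OF fL] ST
        bounded_opD(2)[OF S fL fL, of ?l 0] S_layer[OF f]
      by eventually_elim (simp add: algebra_simps)
    have "L2_inner M (P ?v) ?v = L2_inner M (\<lambda>x. - ?l * ?v x) ?v"
      by (rule L2_inner_cong_AE[OF bounded_opD(1)[OF P v] v L2_scale[OF v] v Pv]) simp
    also have "\<dots> = - ?l * complex_of_real ((L2_norm M ?v)\<^sup>2)"
      by (simp only: L2_inner_scale_left L2_inner_self)
    finally have "lam k * (L2_norm M ?v)\<^sup>2 \<le> 0"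
      using Ppos[OF v] by (simp del: of_real_power)
    then have "L2_norm M ?v = 0"
      using lam_pos[of k] by (simp add: mult_le_0_iff)
    then show ?thesis using L2_norm_eq_0_iff[OF v] by simp
  qed

  have P_steps: "P h \<in> steps n \<and> lam n * (L2_norm M h)\<^sup>2 \<le> Re (L2_inner M (P h) h)"
    if "h \<in> steps n" for h n
    using that
  proof (induction rule: layers_induct)
    case (bottom h)
    note hL = layer_L2[OF bottom]
    have "L2_inner M (P h) h = L2_inner M (\<lambda>x. complex_of_real (lam 0) * h x) h"
      by (rule L2_inner_cong_AE[OF bounded_opD(1)[OF P hL] hL L2_scale[OF hL] hL P_layer[OF bottom]]) simp
    then show ?case
      using steps_AE[OF steps_scale[OF layer_steps[OF bottom]] bounded_opD(1)[OF P hL] P_layer[OF bottom]]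
      by (simp add: L2_inner_scale_left L2_inner_self)
  next
    case (extend n d h)
    note d = extend(1) and h = extend(2)
    note dL = layer_L2[OF d] and hL = steps_L2[OF h]
    have Ph: "P h \<in> steps n" using extend(3) by blast
    note Pd = bounded_opD(1)[OF P dL]
    have "P d \<in> steps (Suc n)"
      using steps_AE[OF steps_scale[OF layer_steps[OF d]] Pd P_layer[OF d]] .
    then have "(\<lambda>x. 1 * P d x + 1 * P h x) \<in> steps (Suc n)"
      using Ph steps_Suc by (intro steps_lincomb) auto
    then have mem: "P (\<lambda>x. 1 * d x + 1 * h x) \<in> steps (Suc n)"
      by (rule steps_AE[OF _ bounded_opD(1)[OF P L2_lincomb[OF dL hL]] bounded_opD(2)[OF P dL hL]])
    have dh: "L2_inner M d h = 0" using layer_perp_steps[OF d _ h] by simp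
    have Pdg: "L2_inner M (P d) g = complex_of_real (lam (Suc n)) * L2_inner M d g"
      if "g \<in> L2 M" for g
      unfolding L2_inner_scale_left[symmetric]
      by (rule L2_inner_cong_AE[OF Pd that L2_scale[OF dL] that P_layer[OF d]]) simp
    have "L2_inner M (P h) d = 0"
      using layer_perp_steps[OF d _ Ph] by (subst L2_inner_commute) simp
    then have "Re (L2_inner M (P (\<lambda>x. 1 * d x + 1 * h x)) (\<lambda>x. 1 * d x + 1 * h x)) =
        lam (Suc n) * (L2_norm M d)\<^sup>2 + Re (L2_inner M (P h) h)"
      unfolding bounded_op_form_add[OF P dL hL] Pdg[OF dL] Pdg[OF hL] dh
      by (simp add: L2_inner_self)
    moreover have "(L2_norm M (\<lambda>x. 1 * d x + 1 * h x))\<^sup>2 = (L2_norm M d)\<^sup>2 + (L2_norm M h)\<^sup>2"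
      using L2_norm_add_square[OF dL hL] dh by simp
    moreover have "lam (Suc n) * (L2_norm M h)\<^sup>2 \<le> lam n * (L2_norm M h)\<^sup>2"
      by (intro mult_right_mono lam_mono) simp
    ultimately show ?case
      using mem extend(3) by (simp add: distrib_left)
  qed

  \<comment> \<open>Both mixed terms in the expansion of the form along \<open>e = avg n e + r\<close> vanish, as \<open>P\<close> preserves step functions.\<close>
  have lower: "lam n * (L2_norm M (avg n e))\<^sup>2 \<le> Re (L2_inner M (P e) e)" if e: "e \<in> E" for e n
  proof -
    have eL: "e \<in> L2 M" using e E by (auto simp: L2_onb_def)
    define h where "h = avg n e"
    define r where "r = (\<lambda>x. e x - h x)"
    have h: "h \<in> steps n" unfolding h_def by (rule avg_steps)
    note hL = steps_L2[OF h]
    have rL: "r \<in> L2 M" unfolding r_def by (intro L2_diff eL hL)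
    have Ph: "P h \<in> steps n" using P_steps[OF h] by blast
    have "L2_inner M r (P h) = 0" using avg_perp[OF eL Ph] by (simp add: r_def h_def)
    then have "L2_inner M (P h) r = 0" "L2_inner M (P r) h = 0"
      using positive_op_symmetric[OF pos rL hL] by (simp_all add: L2_inner_commute[of M "P h"])
    moreover have "(\<lambda>x. 1 * h x + 1 * r x) = e" by (simp add: r_def)
    ultimately have "Re (L2_inner M (P e) e) = Re (L2_inner M (P h) h) + Re (L2_inner M (P r) r)"
      using bounded_op_form_add[OF P hL rL, of 1] by simp
    then show ?thesis using P_steps[OF h] Ppos[OF rL] by (simp add: h_def)
  qed

  have "real (card (cells n)) * lam n \<le> infsum (\<lambda>e. Re (L2_inner M (P e) e)) E" for n
  proof (rule has_sum_mono)
    show "((\<lambda>e. (L2_norm M (avg n e))\<^sup>2 * lam n) has_sum real (card (cells n)) * lam n) E"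
      by (intro has_sum_cmult_left avg_trace E)
    show "((\<lambda>e. Re (L2_inner M (P e) e)) has_sum infsum (\<lambda>e. Re (L2_inner M (P e) e)) E) E"
      by (rule has_sum_infsum[OF sum])
    show "(L2_norm M (avg n e))\<^sup>2 * lam n \<le> Re (L2_inner M (P e) e)" if "e \<in> E" for e
      using lower[OF that, of n] by (simp add: mult.commute)
  qed
  then show ?thesis unfolding lam_def by blast
qed

end

section \<open>The cylinders of a subshift\<close>

text \<open>The positions that a cylinder of length \<open>n\<close> fixes: from \<open>-m\<close> to \<open>m\<close> for \<open>n = 2 m + 1\<close>, and from \<open>1 - m\<close> to
  \<open>m\<close> for \<open>n = 2 m\<close>.\<close>

definition window :: "nat \<Rightarrow> int list" where
  "window n = [(if odd n then 0 else 1) - int (n div 2)..int (n div 2)]"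

lemma window_shift: "window n = map (\<lambda>i. i + ((if odd n then 0 else 1) - int (n div 2) - 1)) [1..int n]"
proof (rule nth_equalityI)
  show len: "length (window n) = length (map (\<lambda>i. i + ((if odd n then 0 else 1) - int (n div 2) - 1)) [1..int n])"
    unfolding window_def by (auto elim!: evenE oddE)
  show "window n ! k = map (\<lambda>i. i + ((if odd n then 0 else 1) - int (n div 2) - 1)) [1..int n] ! k"
    if "k < length (window n)" for k
    using that len unfolding window_def by (auto simp: nth_upto)
qed

lemma length_window: "length (window n) = n"
  by (simp add: window_shift)

text \<open>Going from length \<open>n\<close> to \<open>n + 1\<close> adds one position, alternately at either end; hence the cylinders refine
  each other.\<close>

lemma window_mono: "set (window n) \<subseteq> set (window (Suc n))"
  unfolding window_def by (cases "even n") (auto elim!: evenE oddE)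

lemma window_exhausts:
  assumes "finite I"
  shows "\<exists>n. I \<subseteq> set (window n)"
proof -
  obtain m where m: "\<And>i. i \<in> I \<Longrightarrow> nat \<bar>i\<bar> \<le> m"
    using finite_nat_set_iff_bounded_le[of "(\<lambda>i. nat \<bar>i\<bar>) ` I"] assms by auto
  have "I \<subseteq> set (window (2 * m + 1))"
    using m by (fastforce simp: window_def)
  then show ?thesis ..
qed

lemma cylinder_eq_window: "cylinder X w = {x \<in> X. map x (window (length w)) = w}"
  unfolding cylinder_def window_def by (simp add: Let_def)

lemma subshift_translate:
  assumes "subshift X" "x \<in> X"
  shows "(\<lambda>i. x (i + j)) \<in> X"
proof -
  have img: "left_shift ` X = X" using assms(1) by (simp add: subshift_def)
  have fwd: "(\<lambda>i. x (i + int k)) \<in> X" for k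
  proof (induction k)
    case (Suc k)
    have "left_shift (\<lambda>i. x (i + int k)) \<in> X" using Suc img by blast
    then show ?case by (simp add: left_shift_def add_ac)
  qed (simp add: assms)
  have bwd: "(\<lambda>i. x (i - int k)) \<in> X" for k
  proof (induction k)
    case (Suc k)
    then obtain y where y: "y \<in> X" "left_shift y = (\<lambda>i. x (i - int k))" using img by (metis imageE)
    have "y = (\<lambda>i. x (i - int (Suc k)))"
    proof
      fix i
      show "y i = x (i - int (Suc k))"
        using fun_cong[OF y(2), of "i - 1"] by (simp add: left_shift_def algebra_simps)
    qed
    then show ?case using y(1) by (simp only:)
  qed (simp add: assms)
  show ?thesis
    using fwd[of "nat j"] bwd[of "nat (- j)"] by (cases "j \<ge> 0") auto
qed

text \<open>Words are read at the positions 1 to \<open>n\<close>; invariance under translations moves them into the window,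
  so every word has a non-empty cylinder.\<close>

lemma words_eq_window:
  assumes "subshift X"
  shows "words X n = (\<lambda>x. map x (window n)) ` X"
proof -
  define c where "c = (if odd n then 0 else 1) - int (n div 2) - 1"
  have w: "window n = map (\<lambda>i. i + c) [1..int n]" unfolding c_def by (rule window_shift)
  have "map x [1..int n] \<in> (\<lambda>x. map x (window n)) ` X" if "x \<in> X" for x
    using subshift_translate[OF assms that, of "- c"]
    by (intro image_eqI[of _ _ "\<lambda>i. x (i + - c)"]) (simp_all add: w)
  moreover have "map x (window n) \<in> words X n" if "x \<in> X" for x
    unfolding words_def using subshift_translate[OF assms that, of c]
    by (intro image_eqI[of _ _ "\<lambda>i. x (i + c)"]) (simp_all add: w)
  ultimately show ?thesis unfolding words_def by blast
qed

lemma open_agree_on: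
  fixes x :: "int \<Rightarrow> 'a::discrete_topology"
  assumes "finite I"
  shows "open {y. \<forall>i\<in>I. y i = x i}"
proof -
  have "{y. \<forall>i\<in>I. y i = x i} = (\<Inter>i\<in>I. (\<lambda>y. y i) -` {x i})" by auto
  also have "open \<dots>"
    using assms by (intro open_INT ballI open_vimage Topological_Spaces.open_discrete continuous_on_product_coordinates)
  finally show ?thesis .
qed

text \<open>A neighbourhood in the product topology restricts finitely many coordinates, and some window covers
  them.\<close>

lemma window_neighbourhood:
  fixes x :: "int \<Rightarrow> 'a::topological_space"
  assumes "open V" "x \<in> V"
  shows "\<exists>n. {y. \<forall>i\<in>set (window n). y i = x i} \<subseteq> V"
proof -
  obtain Y where Y: "x \<in> (\<Pi>\<^sub>E i\<in>UNIV. Y i)" "finite {i. Y i \<noteq> UNIV}" "(\<Pi>\<^sub>E i\<in>UNIV. Y i) \<subseteq> V"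
    using product_topology_open_contains_basis[of "\<lambda>_. euclidean :: 'a topology" UNIV V x] assms
    by (auto simp: open_fun_def)
  obtain n where n: "{i. Y i \<noteq> UNIV} \<subseteq> set (window n)" using window_exhausts[OF Y(2)] by blast
  have "y \<in> V" if "\<forall>i\<in>set (window n). y i = x i" for y
  proof -
    have "y i \<in> Y i" for i
      using that n Y(1) by (cases "Y i = UNIV") (auto simp: PiE_iff)
    then show ?thesis using Y(3) by (auto simp: PiE_iff)
  qed
  then show ?thesis by blast
qed

lemma subshift_cells_eq:
  assumes "subshift X"
  shows "cylinder X ` words X n = (\<lambda>x. {y \<in> X. \<forall>i\<in>set (window n). y i = x i}) ` X"
  unfolding words_eq_window[OF assms] image_image
  by (intro image_cong refl) (auto simp: cylinder_eq_window length_window)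

lemma inj_on_cylinder:
  assumes "subshift X"
  shows "inj_on (cylinder X) (words X n)"
proof (rule inj_onI)
  fix v w assume "v \<in> words X n" "w \<in> words X n" and eq: "cylinder X v = cylinder X w"
  then obtain x y where "x \<in> X" "v = map x (window n)" "w = map y (window n)"
    unfolding words_eq_window[OF assms] by blast
  moreover from this have "x \<in> cylinder X w"
    unfolding eq[symmetric] by (simp add: cylinder_eq_window length_window)
  ultimately show "v = w" by (simp add: cylinder_eq_window length_window)
qed

lemma finite_words:
  fixes X :: "(int \<Rightarrow> 'a::finite) set"
  shows "finite (words X n)"
proof (rule finite_subset)
  show "words X n \<subseteq> {w. set w \<subseteq> UNIV \<and> length w = n}" by (auto simp: words_def)
qed (rule finite_lists_length_eq[OF finite])

text \<open>Cylinders are relatively open, and each contains a point of the support of the measure; hence they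
  have positive measure. They are countably many and form a base of the topology, so they generate the
  Borel sets.\<close>

lemma subshift_refining_partitions:
  fixes X :: "(int \<Rightarrow> 'a::{finite, discrete_topology}) set"
  assumes X: "subshift X" and "prob_space \<mu>" and sets: "sets \<mu> = sets (restrict_space borel X)"
    and support: "measure_support \<mu> = X"
  shows "refining_partitions \<mu> (\<lambda>n. cylinder X ` words X n)"
proof -
  interpret prob_space \<mu> by fact
  note cells = subshift_cells_eq[OF X]
  define U where "U n x = {y. \<forall>i\<in>set (window n). y i = x i}" for n and x :: "int \<Rightarrow> 'a"
  have cell: "A \<in> cylinder X ` words X n \<longleftrightarrow> (\<exists>x\<in>X. A = U n x \<inter> X)" for A n
    unfolding cells U_def by blast
  have space: "space \<mu> = X"
    using sets_eq_imp_space_eq[OF sets] by (simp add: space_restrict_space)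
  have U_open: "open (U n x)" for n x unfolding U_def by (intro open_agree_on) simp
  have U_self: "x \<in> U n x" for n x by (simp add: U_def)
  have open_sets: "V \<inter> X \<in> sets \<mu>" if "open V" for V
    unfolding sets using that by (auto simp: sets_restrict_space)
  show ?thesis
  proof
    fix n A B
    show "finite (cylinder X ` words X n)" by (intro finite_imageI finite_words)
    show "disjoint (cylinder X ` words X n)"
    proof (unfold disjoint_def, intro ballI impI)
      fix A B assume "A \<in> cylinder X ` words X n" "B \<in> cylinder X ` words X n" "A \<noteq> B"
      then obtain x y where xy: "A = U n x \<inter> X" "B = U n y \<inter> X" unfolding cell by blast
      have "U n x = U n y" if "z \<in> U n x" "z \<in> U n y" for z
        using that by (simp add: U_def)
      then show "A \<inter> B = {}" using \<open>A \<noteq> B\<close> unfolding xy by blast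
    qed
    show "\<Union>(cylinder X ` words X n) = space \<mu>"
      unfolding space cells by blast
    show "A \<in> sets \<mu>" if "A \<in> cylinder X ` words X n"
      using that open_sets[OF U_open] unfolding cell by blast
    show "measure \<mu> A > 0" if A: "A \<in> cylinder X ` words X n"
    proof -
      obtain x where x: "x \<in> X" "A = U n x \<inter> X" using A unfolding cell by blast
      then have "emeasure \<mu> (U n x \<inter> space \<mu>) > 0"
        using support U_open U_self unfolding measure_support_def by blast
      then show ?thesis
        unfolding x(2) space emeasure_eq_measure by simp
    qed
    show "\<exists>A\<in>cylinder X ` words X n. B \<subseteq> A" if B: "B \<in> cylinder X ` words X (Suc n)"
    proof -
      obtain x where "x \<in> X" "B = U (Suc n) x \<inter> X" using B unfolding cell by blast
      moreover have "U (Suc n) x \<subseteq> U n x" using window_mono[of n] by (auto simp: U_def)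
      ultimately show ?thesis using cell[of "U n x \<inter> X" n] by blast
    qed
    let ?G = "\<Union>n. cylinder X ` words X n"
    have GP: "?G \<subseteq> Pow X" using cell by blast
    show "sets \<mu> = sigma_sets (space \<mu>) ?G"
    proof
      show "sigma_sets (space \<mu>) ?G \<subseteq> sets \<mu>"
      proof (intro sets.sigma_sets_subset subsetI)
        fix A assume "A \<in> ?G"
        then obtain n where "A \<in> cylinder X ` words X n" by (rule UN_E)
        then obtain x where "A = U n x \<inter> X" unfolding cell by blast
        then show "A \<in> sets \<mu>" using open_sets[OF U_open] by simp
      qed
      have "(\<lambda>x. x) \<in> borel_measurable (sigma X ?G)"
      proof (rule borel_measurableI)
        fix V :: "(int \<Rightarrow> 'a) set" assume "open V"
        have "V \<inter> X = \<Union>{A \<in> ?G. A \<subseteq> V}"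
        proof
          show "V \<inter> X \<subseteq> \<Union>{A \<in> ?G. A \<subseteq> V}"
          proof
            fix x assume x: "x \<in> V \<inter> X"
            then obtain n where "U n x \<subseteq> V"
              using window_neighbourhood[OF \<open>open V\<close>, of x] unfolding U_def by blast
            moreover have "U n x \<inter> X \<in> cylinder X ` words X n"
              using x unfolding cell by (intro bexI[of _ x]) auto
            ultimately have "U n x \<inter> X \<in> {A \<in> ?G. A \<subseteq> V}" by blast
            then show "x \<in> \<Union>{A \<in> ?G. A \<subseteq> V}"
              by (rule UnionI) (use x U_self[of x n] in blast)
          qed
          show "\<Union>{A \<in> ?G. A \<subseteq> V} \<subseteq> V \<inter> X" using GP by blast
        qed
        moreover have "countable ?G"
          by (intro countable_UN[OF countableI_type] countable_finite finite_imageI finite_words)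
        then have "countable {A \<in> ?G. A \<subseteq> V}" by (rule countable_subset[rotated]) blast
        then have "\<Union>{A \<in> ?G. A \<subseteq> V} \<in> sets (sigma X ?G)"
          unfolding sets_measure_of[OF GP]
          by (intro sigma_sets_UNION) (blast intro: sigma_sets.Basic)+
        ultimately show "(\<lambda>x. x) -` V \<inter> space (sigma X ?G) \<in> sets (sigma X ?G)"
          by (simp add: space_measure_of[OF GP])
      qed
      then have "V \<inter> X \<in> sigma_sets X ?G" if "V \<in> sets borel" for V
        using measurable_sets[OF _ that, of "\<lambda>x. x" "sigma X ?G"]
        by (simp add: space_measure_of[OF GP] sets_measure_of[OF GP])
      then show "sets \<mu> \<subseteq> sigma_sets (space \<mu>) ?G"
        unfolding sets space by (auto simp: sets_restrict_space Int_commute)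
    qed
  qed
qed

text \<open>Sums over words and sums over cylinders agree because distinct words have distinct cylinders. The
  constants, which are \<open>C\<^sub>0\<close>, are the step functions of the empty word, whose cylinder is \<open>X\<close>.\<close>

lemma subshift_op_eq_number_op:
  fixes X :: "(int \<Rightarrow> 'a::{finite, discrete_topology}) set"
  assumes X: "subshift X" and part: "refining_partitions \<mu> (\<lambda>n. cylinder X ` words X n)"
  shows "subshift_op X \<mu> = refining_partitions.number_op \<mu> (\<lambda>n. cylinder X ` words X n)"
proof -
  interpret refining_partitions \<mu> "\<lambda>n. cylinder X ` words X n" by (rule part)
  have reindex: "(\<Sum>A\<in>cylinder X ` words X n. c A * indicator A x) =
      (\<Sum>w\<in>words X n. c (cylinder X w) * indicator (cylinder X w) x)"
    for c :: "(int \<Rightarrow> 'a) set \<Rightarrow> complex" and n x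
    by (simp add: sum.reindex[OF inj_on_cylinder[OF X]])
  have steps_words: "steps n = {f \<in> L2 \<mu>. \<exists>c. AE x in \<mu>.
      f x = (\<Sum>w\<in>words X n. c w * indicator (cylinder X w) x)}" for n
  proof -
    have "(\<exists>c. AE x in \<mu>. f x = (\<Sum>A\<in>cylinder X ` words X n. c A * indicator A x)) \<longleftrightarrow>
        (\<exists>c. AE x in \<mu>. f x = (\<Sum>w\<in>words X n. c w * indicator (cylinder X w) x))"
      (is "?cells \<longleftrightarrow> ?words") for f :: "(int \<Rightarrow> 'a) \<Rightarrow> complex"
    proof
      assume ?cells
      then obtain c where "AE x in \<mu>. f x = (\<Sum>A\<in>cylinder X ` words X n. c A * indicator A x)" ..
      then show ?words unfolding reindex by (rule exI[of _ "\<lambda>w. c (cylinder X w)"])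
    next
      assume ?words
      then obtain c where c: "AE x in \<mu>. f x = (\<Sum>w\<in>words X n. c w * indicator (cylinder X w) x)" ..
      define c' where "c' A = c (inv_into (words X n) (cylinder X) A)" for A
      have "c' (cylinder X w) = c w" if "w \<in> words X n" for w
        unfolding c'_def using inv_into_f_f[OF inj_on_cylinder[OF X] that] by simp
      then have "(\<Sum>w\<in>words X n. c w * indicator (cylinder X w) x) =
          (\<Sum>A\<in>cylinder X ` words X n. c' A * indicator A x)" for x
        unfolding reindex by (intro sum.cong) auto
      then show ?cells using c by (intro exI[of _ c']) simp
    qed
    then show ?thesis unfolding steps_def by simp
  qed
  have X0: "words X 0 = {[]}" "cylinder X [] = X"
    using X by (auto simp: words_def cylinder_eq_window window_def subshift_def)
  have space: "space \<mu> = X" using Union_cells[of 0] X0 by simp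
  have steps: "cyl_space X \<mu> (int n) = steps n" for n
  proof (cases "n = 0")
    case True
    have single: "(\<Sum>w\<in>words X 0. c w * indicator (cylinder X w) x) = c [] * indicator X x"
      for c :: "'a list \<Rightarrow> complex" and x
      unfolding X0(1) by (subst sum.insert) (simp_all add: X0(2))
    have "(AE x in \<mu>. f x = c) \<longleftrightarrow> (AE x in \<mu>. f x = c * indicator X x)" for f and c :: complex
      by (intro AE_cong) (simp add: space)
    then have "(\<exists>c. AE x in \<mu>. f x = c) \<longleftrightarrow>
        (\<exists>c :: 'a list \<Rightarrow> complex. AE x in \<mu>. f x = c [] * indicator X x)" for f
      by (intro iffI; elim exE) (rule exI[of _ "\<lambda>_. _"], simp, blast)
    then show ?thesis
      unfolding steps_words True cyl_space_def by (simp add: single)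
  qed (simp add: cyl_space_def steps_words)
  have lower: "cyl_space X \<mu> (int n - 1) = lower_steps n" for n
    using steps by (cases n) (simp_all add: lower_steps_def cyl_space_def[of _ _ "-1"])
  show ?thesis
    unfolding subshift_op_def number_op_def layer_def steps lower ..
qed

section \<open>Complexity and summability\<close>

lemma powr_square_bound:
  assumes "s > 0" "n \<ge> 1"
  shows "(1 + (real n)\<^sup>2) powr (s / 2) \<le> 2 powr (s / 2) * real n powr s"
proof -
  have "(real n)\<^sup>2 \<ge> 1" using assms(2) by simp
  then have "(1 + (real n)\<^sup>2) powr (s / 2) \<le> (2 * (real n)\<^sup>2) powr (s / 2)"
    using assms by (intro powr_mono2) auto
  also have "\<dots> = 2 powr (s / 2) * ((real n)\<^sup>2) powr (s / 2)"
    by (rule powr_mult)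
  also have "((real n)\<^sup>2) powr (s / 2) = (real n powr 2) powr (s / 2)"
    using assms(2) by simp
  also have "\<dots> = real n powr s"
    unfolding powr_powr by simp
  finally show ?thesis .
qed

text \<open>By the mean value theorem the differences are of order \<open>n\<^sup>-\<^sup>s\<^sup>-\<^sup>1\<close>, so the terms are of order \<open>n\<^sup>t\<^sup>-\<^sup>s\<^sup>-\<^sup>1\<close>
  with exponent below \<open>-1\<close>.\<close>

lemma summable_weight_differences:
  fixes p :: "nat \<Rightarrow> nat"
  assumes "s > 0" "t < s" and p: "\<And>n. n \<ge> 1 \<Longrightarrow> real (p n) \<le> C * real n powr t"
  shows "summable (\<lambda>n. ((1 + (real n)\<^sup>2) powr (- s / 2) - (1 + (real (Suc n))\<^sup>2) powr (- s / 2)) * real (p n))"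
proof (rule summable_comparison_test_bigo)
  have "(\<lambda>n::nat. (1 + (real n)\<^sup>2) powr (- s / 2) - (1 + (real (Suc n))\<^sup>2) powr (- s / 2))
      \<in> O(\<lambda>n. real n powr (- s - 1))"
    using \<open>s > 0\<close> by real_asymp
  moreover have "(\<lambda>n. real (p n)) \<in> O(\<lambda>n. real n powr t)"
    using p by (intro bigoI[of _ C] eventually_sequentiallyI[of 1]) simp
  ultimately show "(\<lambda>n. ((1 + (real n)\<^sup>2) powr (- s / 2) - (1 + (real (Suc n))\<^sup>2) powr (- s / 2)) * real (p n))
      \<in> O(\<lambda>n. real n powr (- s - 1) * real n powr t)"
    by (rule landau_o.big.mult)
  show "summable (\<lambda>n. norm (real n powr (- s - 1) * real n powr t))"
    using \<open>t < s\<close> by (simp add: powr_add[symmetric] summable_real_powr_iff)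
qed

theorem theorem4p2:
  fixes X :: "(int \<Rightarrow> 'a::{finite, discrete_topology}) set"
    and \<mu> :: "(int \<Rightarrow> 'a) measure"
  assumes "subshift X"
    and "prob_space \<mu>"
    and "sets \<mu> = sets (restrict_space borel X)"
    and "distr \<mu> \<mu> left_shift = \<mu>"
    and "measure_support \<mu> = X"
  shows "(\<forall>C s0 :: real. C \<ge> 1 \<and> s0 \<ge> 1 \<and>
            (\<forall>n::nat. n \<ge> 1 \<longrightarrow> real (card (words X n)) \<le> C * real n powr s0) \<longrightarrow>
            (\<forall>s>s0. s_summable \<mu> (subshift_op X \<mu>) s)) \<and>
         (\<forall>s::real. s > 0 \<and> s_summable \<mu> (subshift_op X \<mu>) s \<longrightarrow>
            (\<exists>C\<ge>1. \<forall>n::nat. n \<ge> 1 \<longrightarrow> real (card (words X n)) \<le> C * real n powr s))"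
proof -
  note part = subshift_refining_partitions[OF assms(1,2,3,5)]
  interpret refining_partitions \<mu> "\<lambda>n. cylinder X ` words X n" by (rule part)
  note op = subshift_op_eq_number_op[OF assms(1) part]
  have card: "card (cylinder X ` words X n) = card (words X n)" for n
    by (rule card_image[OF inj_on_cylinder[OF assms(1)]])
  show ?thesis
  proof (intro conjI allI impI)
    fix C s0 s :: real
    assume h: "C \<ge> 1 \<and> s0 \<ge> 1 \<and>
        (\<forall>n::nat. n \<ge> 1 \<longrightarrow> real (card (words X n)) \<le> C * real n powr s0)" and "s > s0"
    show "s_summable \<mu> (subshift_op X \<mu>) s"
      unfolding op
    proof (rule s_summable_number_op)
      show "s > 0" using h \<open>s > s0\<close> by simp
      then show "summable (\<lambda>n. ((1 + (real n)\<^sup>2) powr (- s / 2) - (1 + (real (Suc n))\<^sup>2) powr (- s / 2)) *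
          real (card (cylinder X ` words X n)))"
        unfolding card using h \<open>s > s0\<close> by (intro summable_weight_differences[of s s0 _ C]) auto
    qed
  next
    fix s :: real
    assume h: "s > 0 \<and> s_summable \<mu> (subshift_op X \<mu>) s"
    then obtain K where K: "\<And>n. real (card (words X n)) * (1 + (real n)\<^sup>2) powr (- s / 2) \<le> K"
      using card_cells_bound_if_s_summable[of s] unfolding op card by blast
    have "K \<ge> 0" using K[of 0] by (rule order_trans[rotated]) simp
    have "real (card (words X n)) \<le> max 1 (K * 2 powr (s / 2)) * real n powr s" if n: "n \<ge> 1" for n
    proof -
      have "real (card (words X n)) =
          real (card (words X n)) * (1 + (real n)\<^sup>2) powr (- s / 2) * (1 + (real n)\<^sup>2) powr (s / 2)"
        by (simp add: mult.assoc powr_add[symmetric] add_nonneg_eq_0_iff)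
      also have "\<dots> \<le> K * (1 + (real n)\<^sup>2) powr (s / 2)"
        by (intro mult_right_mono K) simp
      also have "\<dots> \<le> K * (2 powr (s / 2) * real n powr s)"
        using h n \<open>K \<ge> 0\<close> by (intro mult_left_mono powr_square_bound) auto
      also have "\<dots> \<le> max 1 (K * 2 powr (s / 2)) * real n powr s"
        unfolding mult.assoc[symmetric] by (intro mult_right_mono) auto
      finally show ?thesis .
    qed
    then show "\<exists>C\<ge>1. \<forall>n::nat. n \<ge> 1 \<longrightarrow> real (card (words X n)) \<le> C * real n powr s"
      by (intro exI[of _ "max 1 (K * 2 powr (s / 2))"]) auto
  qed
qed

end
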